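(* Let $W$ be an irreducible finite complex reflection group with reflection representation $V$, let $W_0$ be a parabolic subgroup of $W$, i.e. the (pointwise) stabilizer of an intersection $L$ of reflection hyperplanes, and let $W_0=W_1\times\dots\times W_k$ be its decomposition into irreducible parabolic subgroups, so that $V=\bigoplus_{i=1}^kV_i\oplus L$ where $V_i$ is the reflection representation of $W_i$ and $W_i$ acts trivially on $V_j$ ($j\ne i$) and on $L$. Then the parabolic ideal $I_{W_0}$ is invariant under the Dunkl operators $\nabla_\xi$ for all $\xi\in V$ if and only if $h_{W_i,a}=1$ for every $i=1,\dots,k$.
   Context: Let $\mathcal A$ be the set of reflection hyperplanes of $W$ in $V$. For $H\in\mathcal A$ let $m_H$ be the order of the pointwise stabilizer of $H$ in $W$, let $\alpha_H\in V^*$ be a covector vanishing on $H$, and let $s_{H,i}$, $i=1,\dots,m_H-1$, be the reflections in $W$ fixing $H$ pointwise, numbered so that $s_{H,i}=s_{H,1}^i$ and $\det s_{H,1}=e^{2\pi i/m_H}$. Let $a$ be a $W$-invariant (under conjugation) complex-valued function on the set of reflections, $a_{H,i}=a(s_{H,i})$. $W$ acts on $V^*$ and, by algebra automorphisms extending this action, on the polynomial ring $\mathbb C[x]=S(V^* )$ of $V$. For $\xi\in V$ the Dunkl operator on $\mathbb C[x]$ is $$\nabla_\xi=\partial_\xi-\sum_{H\in\mathcal A}\frac{\alpha_H(\xi)}{\alpha_H}\sum_{i=1}^{m_H-1}a_{H,i}(1-s_{H,i}).$$ For each reflection choose $\alpha_{H,i}\in V^*$, $\alpha_{H,i}^\vee\in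 V$ with $s_{H,i}(f)=f-f(\alpha_{H,i}^\vee)\alpha_{H,i}$ for all $f\in V^*$. For an irreducible reflection group $G$ with reflection representation $V_G$, reflections $s_{H,i}$, and invariant function $a$ on reflections, the number $h_{G,a}$ is the constant such that $$\sum_{H}\sum_{i=1}^{m_H-1}a_{H,i}\,\alpha_{H,i}(v)f(\alpha_{H,i}^\vee)=h_{G,a}\,f(v)\qquad\text{for all }f\in V_G^*,\ v\in V_G,$$ the sum running over the reflections of $G$; equivalently, $\sum_H\sum_i a_{H,i}(1-s_{H,i})$ acts on $V_G^*$ as the scalar $h_{G,a}$. For $G=W_i$ one uses the restriction of $a$ to the reflections of $W$ lying in $W_i$. The parabolic stratum is $D_{W_0}=\bigcup_{w\in W}w(L)$ and the parabolic ideal is $I_{W_0}=\{p\in\mathbb C[x]\mid p|_{D_{W_0}}=0\}$. *)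

theory Defs
  imports "HOL-Analysis.Analysis" "HOL-Algebra.Generated_Groups" "HOL-Algebra.Product_Groups"
begin

text \<open>The complex vector space V is modelled as \<open>complex^'n\<close>; group elements are invertible
  matrices.  All linear notions over the complex numbers use the scalar multiplication \<open>*s\<close>
  (the prefix \<open>vec\<close> of the library), not the underlying real structure.\<close>

definition GL :: "(complex^'n^'n) monoid" where
  "GL = \<lparr>carrier = {A. invertible A}, mult = (**), one = mat 1\<rparr>"

text \<open>The type of matrices carries an entrywise multiplication, so \<open>^\<close> is not the matrix power.\<close>

definition mat_power :: "complex^'n^'n \<Rightarrow> nat \<Rightarrow> complex^'n^'n" where
  "mat_power A i = (((**) A) ^^ i) (mat 1)"

definition fixed_space :: "complex^'n^'n \<Rightarrow> (complex^'n) set" where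
  "fixed_space A = {v. A *v v = v}"

definition reflections :: "(complex^'n^'n) set \<Rightarrow> (complex^'n^'n) set" where
  "reflections G = {s \<in> G. vec.dim (fixed_space s) + 1 = CARD('n)}"

definition hyperplanes :: "(complex^'n^'n) set \<Rightarrow> (complex^'n) set set" where
  "hyperplanes G = fixed_space ` reflections G"

definition pw_stabilizer :: "(complex^'n^'n) set \<Rightarrow> (complex^'n) set \<Rightarrow> (complex^'n^'n) set" where
  "pw_stabilizer G U = {g \<in> G. \<forall>v\<in>U. g *v v = v}"

definition irreducible_on :: "(complex^'n^'n) set \<Rightarrow> (complex^'n) set \<Rightarrow> bool" where
  "irreducible_on G U \<longleftrightarrow>
     vec.subspace U \<and> U \<noteq> {0} \<and> (\<forall>g\<in>G. \<forall>v\<in>U. g *v v \<in> U) \<and>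
     (\<forall>X. vec.subspace X \<and> X \<subseteq> U \<and> (\<forall>g\<in>G. \<forall>v\<in>X. g *v v \<in> X) \<longrightarrow> X = {0} \<or> X = U)"

definition irreducible_reflection_group :: "(complex^'n^'n) set \<Rightarrow> bool" where
  "irreducible_reflection_group W \<longleftrightarrow>
     subgroup W GL \<and> finite W \<and> generate GL (reflections W) = W \<and> irreducible_on W UNIV"

text \<open>The reflection representation of a finite subgroup of GL(V), as a subspace of V: the span of
  all \<open>v - g v\<close>, i.e. the unique stable complement of the space of vectors fixed by the group.\<close>

definition refl_rep :: "(complex^'n^'n) set \<Rightarrow> (complex^'n) set" where
  "refl_rep G = vec.span {v - g *v v | g v. g \<in> G}"

text \<open>The empty intersection is allowed; it gives L = V and the trivial parabolic subgroup.\<close>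

definition hyperplane_intersection :: "(complex^'n^'n) set \<Rightarrow> (complex^'n) set \<Rightarrow> bool" where
  "hyperplane_intersection W L \<longleftrightarrow> (\<exists>B \<subseteq> hyperplanes W. L = \<Inter>B)"

definition parabolic_subgroup :: "(complex^'n^'n) set \<Rightarrow> (complex^'n^'n) set \<Rightarrow> bool" where
  "parabolic_subgroup W P \<longleftrightarrow> (\<exists>L. hyperplane_intersection W L \<and> P = pw_stabilizer W L)"

definition irreducible_parabolic :: "(complex^'n^'n) set \<Rightarrow> (complex^'n^'n) set \<Rightarrow> bool" where
  "irreducible_parabolic W P \<longleftrightarrow> parabolic_subgroup W P \<and> irreducible_on P (refl_rep P)"

text \<open>\<open>G = P 1 \<times> \<dots> \<times> P k\<close> as an internal direct product: the multiplication map is an isomorphism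
  from the external product.\<close>

definition internal_direct_product ::
  "(complex^'n^'n) set \<Rightarrow> nat \<Rightarrow> (nat \<Rightarrow> (complex^'n^'n) set) \<Rightarrow> bool" where
  "internal_direct_product G k P \<longleftrightarrow>
     (\<lambda>g. foldr (\<lambda>i A. g i ** A) [1..<Suc k] (mat 1))
       \<in> iso (product_group {1..k} (\<lambda>i. GL\<lparr>carrier := P i\<rparr>)) (GL\<lparr>carrier := G\<rparr>)"

definition refl_order :: "(complex^'n^'n) set \<Rightarrow> (complex^'n) set \<Rightarrow> nat" where
  "refl_order G H = card (pw_stabilizer G H)"

text \<open>The determinant embeds the pointwise stabilizer of H into the roots of unity, so for a
  reflection hyperplane H of a finite group the element described here exists and is unique.\<close>

definition refl_gen :: "(complex^'n^'n) set \<Rightarrow> (complex^'n) set \<Rightarrow> complex^'n^'n" where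
  "refl_gen G H = (THE s. s \<in> pw_stabilizer G H \<and>
     det s = exp (2 * of_real pi * \<i> / of_nat (refl_order G H)))"

definition refl_elt :: "(complex^'n^'n) set \<Rightarrow> (complex^'n) set \<Rightarrow> nat \<Rightarrow> complex^'n^'n" where
  "refl_elt G H i = mat_power (refl_gen G H) i"

definition refl_invariant :: "(complex^'n^'n) set \<Rightarrow> (complex^'n^'n \<Rightarrow> complex) \<Rightarrow> bool" where
  "refl_invariant W a \<longleftrightarrow> (\<forall>w\<in>W. \<forall>s\<in>reflections W. a (w ** s ** matrix_inv w) = a s)"

definition covectors :: "(complex^'n \<Rightarrow> complex) set" where
  "covectors = {f. Vector_Spaces.linear (*s) (*) f}"

text \<open>The polynomial ring S(V*), realised as the algebra of functions on V generated by the
  covectors (evaluation is injective since the field is infinite).\<close>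

inductive_set polynomials :: "(complex^'n \<Rightarrow> complex) set" where
  const: "(\<lambda>x. c) \<in> polynomials"
| covector: "f \<in> covectors \<Longrightarrow> f \<in> polynomials"
| add: "p \<in> polynomials \<Longrightarrow> q \<in> polynomials \<Longrightarrow> (\<lambda>x. p x + q x) \<in> polynomials"
| mult: "p \<in> polynomials \<Longrightarrow> q \<in> polynomials \<Longrightarrow> (\<lambda>x. p x * q x) \<in> polynomials"

definition act :: "complex^'n^'n \<Rightarrow> (complex^'n \<Rightarrow> complex) \<Rightarrow> complex^'n \<Rightarrow> complex" where
  "act g p = (\<lambda>x. p (matrix_inv g *v x))"

definition dir_deriv :: "complex^'n \<Rightarrow> (complex^'n \<Rightarrow> complex) \<Rightarrow> complex^'n \<Rightarrow> complex" where
  "dir_deriv \<xi> p = (\<lambda>x. deriv (\<lambda>t. p (x + t *s \<xi>)) 0)"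

text \<open>Exact division in the polynomial ring.  Pointwise division would give the wrong value on
  the zero set of the divisor.\<close>

definition poly_quot ::
  "(complex^'n \<Rightarrow> complex) \<Rightarrow> (complex^'n \<Rightarrow> complex) \<Rightarrow> complex^'n \<Rightarrow> complex" where
  "poly_quot p d = (THE q. q \<in> polynomials \<and> (\<forall>x. p x = d x * q x))"

definition dunkl ::
  "(complex^'n^'n) set \<Rightarrow> (complex^'n^'n \<Rightarrow> complex) \<Rightarrow> ((complex^'n) set \<Rightarrow> complex^'n \<Rightarrow> complex)
    \<Rightarrow> complex^'n \<Rightarrow> (complex^'n \<Rightarrow> complex) \<Rightarrow> complex^'n \<Rightarrow> complex" where
  "dunkl W a \<alpha> \<xi> p = (\<lambda>x. dir_deriv \<xi> p x -
     (\<Sum>H\<in>hyperplanes W. \<alpha> H \<xi> *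
        poly_quot (\<lambda>y. \<Sum>i=1..refl_order W H - 1.
          a (refl_elt W H i) * (p y - act (refl_elt W H i) p y)) (\<alpha> H) x))"

text \<open>\<open>\<beta> s\<close> and \<open>\<gamma> s\<close> stand for the covector and vector attached to the reflection s.
  The covectors of the reflection representation of G are the restrictions of covectors of V.\<close>

definition h_const ::
  "(complex^'n^'n) set \<Rightarrow> (complex^'n^'n \<Rightarrow> complex) \<Rightarrow> (complex^'n^'n \<Rightarrow> complex^'n \<Rightarrow> complex)
    \<Rightarrow> (complex^'n^'n \<Rightarrow> complex^'n) \<Rightarrow> complex" where
  "h_const G a \<beta> \<gamma> = (THE h. \<forall>f\<in>covectors. \<forall>v\<in>refl_rep G.
     (\<Sum>H\<in>hyperplanes G. \<Sum>i=1..refl_order G H - 1.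
        a (refl_elt G H i) * \<beta> (refl_elt G H i) v * f (\<gamma> (refl_elt G H i))) = h * f v)"

definition parabolic_stratum ::
  "(complex^'n^'n) set \<Rightarrow> (complex^'n) set \<Rightarrow> (complex^'n) set" where
  "parabolic_stratum W L = (\<Union>w\<in>W. (\<lambda>v. w *v v) ` L)"

definition parabolic_ideal ::
  "(complex^'n^'n) set \<Rightarrow> (complex^'n) set \<Rightarrow> (complex^'n \<Rightarrow> complex) set" where
  "parabolic_ideal W L = {p \<in> polynomials. \<forall>x\<in>parabolic_stratum W L. p x = 0}"

end

theory Submission
  imports Defs "HOL-Computational_Algebra.Fundamental_Theorem_Algebra"
begin

text \<open>Let p vanish on the stratum and let x be a generic point of \<open>w L\<close>, with gradient f of p
  at x.  A reflection moving x contributes nothing to the Dunkl operator at x, because p vanishes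
  at x and at its image; a reflection fixing x fixes \<open>w L\<close> pointwise, and differentiating along
  \<open>\<xi>\<close> gives \<open>\<nabla>\<^sub>\<xi> p (x) = f (\<xi> - w A (w\<inverse> \<xi>))\<close>, where A is the sum of the operators
  \<open>a\<^sub>s (1 - s\<inverse>)\<close> over the reflections s of \<open>W\<^sub>0\<close>.  The covector \<open>f \<circ> w\<close> vanishes on L.

  The operator A is zero on L and, by Schur's lemma, the scalar \<open>h\<^sub>i\<close> on \<open>V\<^sub>i\<close>, since a reflection
  of \<open>W\<^sub>0\<close> outside \<open>W\<^sub>i\<close> acts trivially on \<open>V\<^sub>i\<close>.  If every \<open>h\<^sub>i\<close> is 1, then \<open>1 - A\<close> maps V to L,
  so \<open>\<nabla>\<^sub>\<xi> p\<close> vanishes at generic points of the stratum, hence on all of it.  Conversely, multiply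
  a linear form l vanishing on L by linear forms that vanish on the translates \<open>w L \<noteq> L\<close> but not
  at a generic point of L: this lies in the ideal, its gradient is proportional to l, and for
  \<open>\<xi> \<in> V\<^sub>i\<close> with \<open>l \<xi> \<noteq> 0\<close> the invariance forces \<open>h\<^sub>i = 1\<close>.\<close>

section \<open>Linear forms and polynomials\<close>

lemma covectors_iff:
  "f \<in> covectors \<longleftrightarrow> (\<forall>x y. f (x + y) = f x + f y) \<and> (\<forall>c x. f (c *s x) = c * f x)"
proof -
  have "vector_space ((*) :: complex \<Rightarrow> complex \<Rightarrow> complex)"
    by unfold_locales (auto simp: algebra_simps)
  moreover have "vector_space ((*s) :: complex \<Rightarrow> complex^'a \<Rightarrow> complex^'a)"
    by (rule vec.vector_space_axioms)
  ultimately show ?thesis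
    by (simp add: covectors_def Vector_Spaces.linear_iff)
qed

lemma covector_add: "f \<in> covectors \<Longrightarrow> f (x + y) = f x + f y"
  and covector_scale: "f \<in> covectors \<Longrightarrow> f (c *s x) = c * f x"
  by (auto simp: covectors_iff)

lemma covector_0: "f \<in> covectors \<Longrightarrow> f 0 = 0"
  using covector_scale[of f 0 0] by simp

lemma covector_diff: "f \<in> covectors \<Longrightarrow> f (x - y) = f x - f y"
  using covector_add[of f "x - y" y] by simp

lemma covector_sum: "f \<in> covectors \<Longrightarrow> f (sum g A) = (\<Sum>i\<in>A. f (g i))"
  by (induction A rule: infinite_finite_induct) (auto simp: covector_0 covector_add)

lemma covector_compose: "f \<in> covectors \<Longrightarrow> (\<lambda>x. f (A *v x)) \<in> covectors"
  by (simp add: covectors_iff matrix_vector_right_distrib vector_scalar_commute)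

lemma coordinate_covector: "(\<lambda>x. x $ i) \<in> covectors"
  by (simp add: covectors_iff)

lemma subspace_covector_kernel: "f \<in> covectors \<Longrightarrow> vec.subspace {x. f x = 0}"
  by (simp add: vec.subspace_def covector_0 covector_add covector_scale)

lemma covector_line: "f \<in> covectors \<Longrightarrow> f (x + t *s v) = f x + t * f v"
  by (simp add: covector_add covector_scale)

text \<open>A basis of \<open>K\<close> extended by \<open>v\<close> carries a linear map that kills
  \<open>K\<close> and fixes \<open>v\<close>; a nonzero coordinate of \<open>v\<close> turns it
  into a scalar form.\<close>

lemma separating_covector:
  fixes K :: "(complex^'n) set"
  assumes K: "vec.subspace K" and v: "v \<notin> K"
  obtains f where "f \<in> covectors" "\<And>x. x \<in> K \<Longrightarrow> f x = 0" "f v \<noteq> 0"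
proof -
  obtain B where B: "B \<subseteq> K" "vec.independent B" "K \<subseteq> vec.span B"
    using vec.basis_exists[of K] by metis
  have spanB: "vec.span B = K"
    by (rule vec.span_subspace[OF B(1,3) K])
  have "vec.independent (insert v B)"
    using B v spanB by (simp add: vec.independent_insert)
  then obtain g where g: "Vector_Spaces.linear (*s) (*s) g"
      "\<forall>x\<in>insert v B. g x = (if x = v then v else 0)"
    using vec.linear_independent_extend[of "insert v B" "\<lambda>x. if x = v then v else 0"] by auto
  have "v \<noteq> 0" using v K vec.subspace_0 by auto
  then obtain i where i: "v $ i \<noteq> 0" by (auto simp: vec_eq_iff)
  have f: "(\<lambda>x. g x $ i) \<in> covectors"
    using g(1) by (simp add: covectors_iff Vector_Spaces.linear_iff)
  moreover have "g x $ i = 0" if "x \<in> K" for x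
  proof -
    have "x \<in> vec.span B" using that spanB by simp
    then show ?thesis
    proof (rule vec.span_induct)
      show "vec.subspace {x. g x $ i = 0}" using subspace_covector_kernel[OF f] .
      show "g x $ i = 0" if "x \<in> B" for x
        using that g(2) v B(1) by auto
    qed
  qed
  moreover have "g v $ i \<noteq> 0" using g(2) i by simp
  ultimately show ?thesis using that[of "\<lambda>x. g x $ i"] by blast
qed

section \<open>Polynomial functions, their restrictions to lines, and generic points\<close>

lemma polynomials_sum: "(\<And>i. i \<in> A \<Longrightarrow> p i \<in> polynomials) \<Longrightarrow> (\<lambda>x. \<Sum>i\<in>A. p i x) \<in> polynomials"
  by (induction A rule: infinite_finite_induct) (auto intro: polynomials.intros)

lemma polynomials_prod: "(\<And>i. i \<in> A \<Longrightarrow> p i \<in> polynomials) \<Longrightarrow> (\<lambda>x. \<Prod>i\<in>A. p i x) \<in> polynomials"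
  by (induction A rule: infinite_finite_induct) (auto intro: polynomials.intros)

lemma polynomials_cmult: "p \<in> polynomials \<Longrightarrow> (\<lambda>x. c * p x) \<in> polynomials"
  by (rule polynomials.mult[OF polynomials.const])

lemma polynomials_diff: "p \<in> polynomials \<Longrightarrow> q \<in> polynomials \<Longrightarrow> (\<lambda>x. p x - q x) \<in> polynomials"
  using polynomials.add[of p "\<lambda>x. (-1) * q x"] by (simp add: polynomials_cmult[of q "-1", simplified])

lemma polynomials_compose:
  assumes "p \<in> polynomials" "\<And>f. f \<in> covectors \<Longrightarrow> (\<lambda>x. f (g x)) \<in> covectors"
  shows "(\<lambda>x. p (g x)) \<in> polynomials"
  using assms(1) by induction (auto intro: polynomials.intros assms(2))

lemma polynomials_act: "p \<in> polynomials \<Longrightarrow> act g p \<in> polynomials"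
  unfolding act_def by (rule polynomials_compose) (auto intro: covector_compose)

text \<open>Reduces several variables to one, where a nonzero polynomial has only finitely many
  roots.\<close>

lemma polynomial_on_line:
  assumes "p \<in> polynomials"
  obtains q where "\<And>t. p (x + t *s v) = poly q t"
proof -
  have "\<exists>q. \<forall>t. p (x + t *s v) = poly q t"
    using assms
  proof induction
    case (const c)
    show ?case by (rule exI[of _ "[:c:]"]) simp
  next
    case (covector f)
    show ?case by (rule exI[of _ "[:f x, f v:]"]) (simp add: covector covector_line)
  next
    case (add p q)
    then obtain p' q' where "\<forall>t. p (x + t *s v) = poly p' t" "\<forall>t. q (x + t *s v) = poly q' t"
      by blast
    then show ?case by (intro exI[of _ "p' + q'"]) simp
  next
    case (mult p q)
    then obtain p' q' where "\<forall>t. p (x + t *s v) = poly p' t" "\<forall>t. q (x + t *s v) = poly q' t"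
      by blast
    then show ?case by (intro exI[of _ "p' * q'"]) simp
  qed
  then show ?thesis using that by blast
qed

lemma finite_covector_zeros_on_line:
  assumes "f \<in> covectors" "f x \<noteq> 0 \<or> f v \<noteq> 0"
  shows "finite {t. f (x + t *s v) = 0}"
proof (cases "f v = 0")
  case True
  then show ?thesis using assms by (simp add: covector_line)
next
  case False
  have "{t. f (x + t *s v) = 0} \<subseteq> {- f x / f v}"
    using False by (auto simp: covector_line[OF assms(1)] field_simps add_eq_0_iff)
  then show ?thesis using finite_subset by blast
qed

text \<open>Moving the point found for \<open>F\<close> along a vector of \<open>K\<close> on which
  the new form is nonzero spoils only finitely many parameters. In effect, \<open>K\<close> is no
  finite union of proper subspaces.\<close>

lemma generic_point:
  assumes K: "vec.subspace K" and F: "finite F" "F \<subseteq> covectors" "\<And>f. f \<in> F \<Longrightarrow> \<exists>x\<in>K. f x \<noteq> 0"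
  obtains x where "x \<in> K" "\<And>f. f \<in> F \<Longrightarrow> f x \<noteq> 0"
proof -
  have "\<exists>x\<in>K. \<forall>f\<in>F. f x \<noteq> 0"
    using F
  proof (induction F)
    case empty
    then show ?case using K vec.subspace_0 by auto
  next
    case (insert f F)
    then obtain x where x: "x \<in> K" "\<forall>f\<in>F. f x \<noteq> 0" by auto
    obtain y where y: "y \<in> K" "f y \<noteq> 0" using insert.prems by blast
    have "finite (\<Union>g\<in>insert f F. {t. g (x + t *s y) = 0})"
      using insert.prems insert.hyps x y by (intro finite_UN_I finite_covector_zeros_on_line) auto
    then obtain t where "t \<notin> (\<Union>g\<in>insert f F. {t. g (x + t *s y) = 0})"
      using ex_new_if_finite[OF infinite_UNIV_char_0] by blast
    moreover have "x + t *s y \<in> K"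
      using x y K by (simp add: vec.subspace_add vec.subspace_scale)
    ultimately show ?case by blast
  qed
  then show ?thesis using that by blast
qed

text \<open>Density argument, used to pass from generic points of a translate of \<open>L\<close> to
  the whole translate, and from the complement of a hyperplane to the whole space.\<close>

lemma polynomial_vanishes_if_generic:
  assumes K: "vec.subspace K" and F: "finite F" "F \<subseteq> covectors" "\<And>f. f \<in> F \<Longrightarrow> \<exists>x\<in>K. f x \<noteq> 0"
    and p: "p \<in> polynomials" and 0: "\<And>x. x \<in> K \<Longrightarrow> (\<And>f. f \<in> F \<Longrightarrow> f x \<noteq> 0) \<Longrightarrow> p x = 0"
    and y: "y \<in> K"
  shows "p y = 0"
proof -
  obtain x where x: "x \<in> K" "\<And>f. f \<in> F \<Longrightarrow> f x \<noteq> 0"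
    using generic_point[OF K F] by blast
  \<comment> \<open>The line through \<open>y\<close> runs in the direction of the generic
    \<open>x\<close>, so each form in \<open>F\<close> vanishes on it at most once.\<close>
  obtain q where q: "\<And>t. p (y + t *s x) = poly q t"
    using polynomial_on_line[OF p] by blast
  define Z where "Z = (\<Union>g\<in>F. {t. g (y + t *s x) = 0})"
  have "finite Z"
    unfolding Z_def using F x by (intro finite_UN_I finite_covector_zeros_on_line) auto
  have "poly q t = 0" if "t \<notin> Z" for t
  proof -
    have "y + t *s x \<in> K" using x y K by (simp add: vec.subspace_add vec.subspace_scale)
    then show ?thesis using 0 that q unfolding Z_def by fastforce
  qed
  then have "- Z \<subseteq> {t. poly q t = 0}" by auto
  moreover have "infinite (- Z)"
    using \<open>finite Z\<close> by (simp add: Compl_eq_Diff_UNIV Diff_infinite_finite infinite_UNIV_char_0)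
  ultimately have "q = 0" using poly_roots_finite finite_subset by blast
  then show ?thesis using q[of 0] by simp
qed

section \<open>Exact division by a linear form\<close>

lemma covector_quotient_unique:
  assumes d: "d \<in> covectors" "d \<noteq> (\<lambda>v. 0)" and q: "q \<in> polynomials" "r \<in> polynomials"
    and eq: "\<And>x. d x * q x = d x * r x"
  shows "q = r"
proof
  fix y
  obtain v where "d v \<noteq> 0" using d(2) by auto
  have "q y - r y = 0"
  proof (rule polynomial_vanishes_if_generic[where K = UNIV and F = "{d}"])
    show "(\<lambda>x. q x - r x) \<in> polynomials" using q by (rule polynomials_diff)
    show "q x - r x = 0" if "\<And>f. f \<in> {d} \<Longrightarrow> f x \<noteq> 0" for x
      using eq[of x] that by simp
  qed (use d \<open>d v \<noteq> 0\<close> in auto)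
  then show "q y = r y" by simp
qed

text \<open>Let \<open>g\<close> be the projection along \<open>v\<close> onto the kernel of
  \<open>d\<close>. Then \<open>d\<close> divides the difference of \<open>p\<close> and its
  composite with \<open>g\<close>, and this composite is zero because \<open>p\<close> vanishes on
  the kernel.\<close>

lemma covector_dvd_polynomial:
  assumes d: "d \<in> covectors" "d \<noteq> (\<lambda>v. 0)" and p: "p \<in> polynomials"
    and 0: "\<And>x. d x = 0 \<Longrightarrow> p x = 0"
  obtains q where "q \<in> polynomials" "\<And>x. p x = d x * q x"
proof -
  obtain u where u: "d u \<noteq> 0" using d(2) by auto
  define v where "v = inverse (d u) *s u"
  have v: "d v = 1" using u d by (simp add: v_def covector_scale)
  define g where "g x = x - d x *s v" for x
  have g: "(\<lambda>x. f (g x)) \<in> covectors" if "f \<in> covectors" for f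
    unfolding g_def using that d(1) by (simp add: covectors_iff covector_diff covector_scale algebra_simps)
  \<comment> \<open>The induction treats this difference because vanishing on the kernel is not
    inherited by summands and factors.\<close>
  have "\<exists>q\<in>polynomials. \<forall>x. p x - p (g x) = d x * q x"
    using p
  proof induction
    case (const c)
    show ?case by (rule bexI[of _ "\<lambda>x. 0"]) (auto intro: polynomials.const)
  next
    case (covector f)
    show ?case by (rule bexI[of _ "\<lambda>x. f v"])
      (auto simp: g_def covector covector_diff covector_scale intro: polynomials.const)
  next
    case (add p q)
    then obtain p' q' where *: "p' \<in> polynomials" "q' \<in> polynomials"
        "\<And>x. p x - p (g x) = d x * p' x" "\<And>x. q x - q (g x) = d x * q' x" by blast
    have "(p x + q x) - (p (g x) + q (g x)) = d x * (p' x + q' x)" for x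
      by (simp only: distrib_left flip: *) simp
    moreover have "(\<lambda>x. p' x + q' x) \<in> polynomials"
      using *(1,2) by (rule polynomials.add)
    ultimately show ?case by (intro bexI[of _ "\<lambda>x. p' x + q' x"] allI)
  next
    case (mult p q)
    then obtain p' q' where *: "p' \<in> polynomials" "q' \<in> polynomials"
        "\<And>x. p x - p (g x) = d x * p' x" "\<And>x. q x - q (g x) = d x * q' x" by blast
    have "p x * q x - p (g x) * q (g x) = d x * (p' x * q x + p (g x) * q' x)" for x
    proof -
      have "p x * q x - p (g x) * q (g x) = (p x - p (g x)) * q x + p (g x) * (q x - q (g x))"
        by (simp add: algebra_simps)
      then show ?thesis by (simp only: *) (simp add: algebra_simps)
    qed
    moreover have "(\<lambda>x. p' x * q x + p (g x) * q' x) \<in> polynomials"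
      using * mult.hyps by (intro polynomials.add polynomials.mult polynomials_compose[of p g] g)
    ultimately show ?case by (intro bexI[of _ "\<lambda>x. p' x * q x + p (g x) * q' x"] allI)
  qed
  then obtain q where q: "q \<in> polynomials" "\<And>x. p x - p (g x) = d x * q x" by blast
  have "p (g x) = 0" for x
    using 0 v d(1) by (simp add: g_def covector_diff covector_scale)
  then show ?thesis using that q by simp
qed

lemma poly_quot_spec:
  assumes d: "d \<in> covectors" "d \<noteq> (\<lambda>v. 0)" and p: "p \<in> polynomials"
    and 0: "\<And>x. d x = 0 \<Longrightarrow> p x = 0"
  shows "poly_quot p d \<in> polynomials" "p x = d x * poly_quot p d x"
proof -
  obtain q where q: "q \<in> polynomials" "\<And>x. p x = d x * q x"
    using covector_dvd_polynomial[OF assms] by blast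
  have "\<exists>!q. q \<in> polynomials \<and> (\<forall>x. p x = d x * q x)"
  proof (rule ex1I[of _ q])
    show "q \<in> polynomials \<and> (\<forall>x. p x = d x * q x)" using q by blast
    show "r = q" if "r \<in> polynomials \<and> (\<forall>x. p x = d x * r x)" for r
      using that q by (intro covector_quotient_unique[OF d]) auto
  qed
  from theI'[OF this] have "poly_quot p d \<in> polynomials \<and> (\<forall>x. p x = d x * poly_quot p d x)"
    unfolding poly_quot_def .
  then show "poly_quot p d \<in> polynomials" "p x = d x * poly_quot p d x" by simp_all
qed

section \<open>Gradients and directional derivatives of polynomials\<close>

text \<open>Existence of the derivatives and their linearity in the direction come from one
  induction; the product rule supplies the covector of a product.\<close>

lemma polynomial_gradient:
  assumes "p \<in> polynomials"
  obtains f where "f \<in> covectors"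
    "\<And>v. ((\<lambda>t. p (x + t *s v)) has_field_derivative f v) (at 0)"
proof -
  have "\<exists>f\<in>covectors. \<forall>v. ((\<lambda>t. p (x + t *s v)) has_field_derivative f v) (at 0)"
    using assms
  proof induction
    case (const c)
    show ?case by (rule bexI[of _ "\<lambda>v. 0"]) (auto simp: covectors_iff)
  next
    case (covector f)
    show ?case
      by (rule bexI[of _ f]) (auto simp: covector covector_line intro!: derivative_eq_intros)
  next
    case (add p q)
    then obtain f g where *: "f \<in> covectors" "g \<in> covectors" 
        "\<And>v. ((\<lambda>t. p (x + t *s v)) has_field_derivative f v) (at 0)"
        "\<And>v. ((\<lambda>t. q (x + t *s v)) has_field_derivative g v) (at 0)" by blast
    have "(\<lambda>v. f v + g v) \<in> covectors"
      using *(1,2) by (simp add: covectors_iff algebra_simps)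
    with * show ?case by (intro bexI[of _ "\<lambda>v. f v + g v"] allI DERIV_add)
  next
    case (mult p q)
    then obtain f g where *: "f \<in> covectors" "g \<in> covectors" 
        "\<And>v. ((\<lambda>t. p (x + t *s v)) has_field_derivative f v) (at 0)"
        "\<And>v. ((\<lambda>t. q (x + t *s v)) has_field_derivative g v) (at 0)" by blast
    have "(\<lambda>v. f v * q x + g v * p x) \<in> covectors"
      using *(1,2) by (simp add: covectors_iff algebra_simps)
    moreover have "((\<lambda>t. p (x + t *s v) * q (x + t *s v)) has_field_derivative f v * q x + g v * p x) (at 0)" for v
      using DERIV_mult[OF *(3,4)] by simp
    ultimately show ?case by (intro bexI[of _ "\<lambda>v. f v * q x + g v * p x"] allI)
  qed
  then show ?thesis using that by blast
qed

lemma dir_deriv_polynomial: "p \<in> polynomials \<Longrightarrow> dir_deriv \<xi> p \<in> polynomials"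
proof (induction rule: polynomials.induct)
  case (const c)
  then show ?case by (simp add: dir_deriv_def polynomials.const)
next
  case (covector f)
  have "((\<lambda>t. f (x + t *s \<xi>)) has_field_derivative f \<xi>) (at 0)" for x
    by (auto simp: covector covector_line intro!: derivative_eq_intros)
  then have "dir_deriv \<xi> f = (\<lambda>x. f \<xi>)"
    unfolding dir_deriv_def by (intro ext DERIV_imp_deriv)
  then show ?case by (simp add: polynomials.const)
next
  case (add p q)
  have "dir_deriv \<xi> (\<lambda>x. p x + q x) = (\<lambda>x. dir_deriv \<xi> p x + dir_deriv \<xi> q x)"
  proof
    fix x
    obtain f where f: "\<And>v. ((\<lambda>t. p (x + t *s v)) has_field_derivative f v) (at 0)"
      using polynomial_gradient[OF add.hyps(1), of x] by metis
    obtain g where g: "\<And>v. ((\<lambda>t. q (x + t *s v)) has_field_derivative g v) (at 0)"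
      using polynomial_gradient[OF add.hyps(2), of x] by metis
    from f[of \<xi>] g[of \<xi>] DERIV_add[OF f[of \<xi>] g[of \<xi>]] show "dir_deriv \<xi> (\<lambda>x. p x + q x) x = dir_deriv \<xi> p x + dir_deriv \<xi> q x"
      by (simp add: dir_deriv_def DERIV_imp_deriv)
  qed
  with add.IH show ?case by (simp add: polynomials.add)
next
  case (mult p q)
  have "dir_deriv \<xi> (\<lambda>x. p x * q x) = (\<lambda>x. dir_deriv \<xi> p x * q x + dir_deriv \<xi> q x * p x)"
  proof
    fix x
    obtain f where f: "\<And>v. ((\<lambda>t. p (x + t *s v)) has_field_derivative f v) (at 0)"
      using polynomial_gradient[OF mult.hyps(1), of x] by metis
    obtain g where g: "\<And>v. ((\<lambda>t. q (x + t *s v)) has_field_derivative g v) (at 0)"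
      using polynomial_gradient[OF mult.hyps(2), of x] by metis
    from f[of \<xi>] g[of \<xi>] DERIV_mult[OF f[of \<xi>] g[of \<xi>]] show "dir_deriv \<xi> (\<lambda>x. p x * q x) x = dir_deriv \<xi> p x * q x + dir_deriv \<xi> q x * p x"
      by (simp add: dir_deriv_def DERIV_imp_deriv)
  qed
  with mult show ?case by (simp add: polynomials.add polynomials.mult)
qed

section \<open>Finite linear groups and their reflections\<close>

lemma subspace_fixed_space: "vec.subspace (fixed_space A)"
  by (simp add: fixed_space_def vec.subspace_def matrix_vector_right_distrib vector_scalar_commute)

section \<open>Hyperplanes and the maps that fix them pointwise\<close>

text \<open>A zero of \<open>d\<close> outside \<open>H\<close> would span the whole space together
  with \<open>H\<close>, making \<open>d\<close> zero.\<close>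

lemma hyperplane_eq_kernel:
  fixes H :: "(complex^'n) set"
  assumes H: "vec.subspace H" "vec.dim H + 1 = CARD('n)"
    and d: "d \<in> covectors" "d \<noteq> (\<lambda>v. 0)" "\<forall>v\<in>H. d v = 0"
  shows "d x = 0 \<longleftrightarrow> x \<in> H"
proof
  assume x: "d x = 0"
  show "x \<in> H"
  proof (rule ccontr)
    assume "x \<notin> H"
    then have "x \<notin> vec.span H" using H(1) by (metis vec.span_eq_iff)
    then have "vec.dim (insert x H) = CARD('n)"
      using H by (simp add: vec.dim_insert)
    then have "vec.span (insert x H) = UNIV"
      using vec.dim_eq_full[of "insert x H"] vec_dim_card by (metis vec.dim_UNIV vec.dimension_def)
    moreover have "vec.span (insert x H) \<subseteq> {y. d y = 0}"
      using x d by (intro vec.span_minimal subspace_covector_kernel) auto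
    ultimately show False using d(2) by fastforce
  qed
qed (use d in blast)

text \<open>If \<open>d v = 1\<close>, then \<open>x - d x *s v\<close> lies in \<open>H\<close> and
  is fixed, so \<open>s\<close> is determined by its value at \<open>v\<close>. The vector
  \<open>u\<close> is \<open>v - s *v v\<close>.\<close>

lemma fixes_hyperplane_form:
  fixes H :: "(complex^'n) set"
  assumes "vec.subspace H" "vec.dim H + 1 = CARD('n)"
    and d: "d \<in> covectors" "d \<noteq> (\<lambda>v. 0)" "\<forall>v\<in>H. d v = 0"
    and s: "\<forall>v\<in>H. s *v v = v"
  obtains u where "\<And>x. s *v x = x - d x *s u"
proof -
  obtain w where w: "d w \<noteq> 0" using d(2) by auto
  define v where "v = inverse (d w) *s w"
  have v: "d v = 1" using w d by (simp add: v_def covector_scale)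
  have "s *v x = x - d x *s (v - s *v v)" for x
  proof -
    have "d (x - d x *s v) = 0"
      using v d(1) by (simp add: covector_diff covector_scale)
    then have "x - d x *s v \<in> H"
      using hyperplane_eq_kernel[OF assms(1-5)] by simp
    then have "s *v (x - d x *s v) = x - d x *s v" using s by blast
    then show ?thesis
      by (simp add: matrix_vector_mult_diff_distrib vector_scalar_commute vec.scale_right_diff_distrib algebra_simps)
  qed
  then show ?thesis using that by blast
qed

lemma covector_expansion:
  fixes d :: "complex^'n \<Rightarrow> complex"
  assumes "d \<in> covectors"
  shows "d x = (\<Sum>j\<in>UNIV. d (axis j 1) * x $ j)"
proof -
  have "d x = d (\<Sum>j\<in>UNIV. x $ j *s axis j 1)" by (simp add: basis_expansion)
  then show ?thesis using assms by (simp add: covector_sum covector_scale mult.commute)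
qed

lemma matrix_vector_mult_axis: "((A :: complex^'n^'m) *v axis j 1) $ i = A $ i $ j"
  by (simp add: matrix_vector_mult_def axis_def if_distrib cong: if_cong)

text \<open>For a suitable base change \<open>A\<close>, the matrices \<open>s ** A\<close> and
  \<open>A\<close> differ in one column only, so Cramer's rule yields the determinant.\<close>

lemma det_rank_one_update:
  fixes s :: "complex^'n^'n"
  assumes d: "d \<in> covectors" and s: "\<And>x. s *v x = x - d x *s u"
  shows "det s = 1 - d u"
proof (cases "d = (\<lambda>v. 0)")
  case True
  then have "s = mat 1" using s by (simp add: matrix_eq)
  with True show ?thesis by simp
next
  case False
  then obtain x where "d x \<noteq> 0" by auto
  then obtain k where k: "d (axis k 1) \<noteq> 0"
    using covector_expansion[OF d, of x] by (metis (no_types, lifting) mult_zero_left sum.neutral)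
  \<comment> \<open>In the coordinates D, where d becomes the k-th coordinate, s changes only the k-th column.\<close>
  define D :: "complex^'n^'n" where "D = (\<chi> i j. if i = k then d (axis j 1) else mat 1 $ i $ j)"
  have D: "(D *v x) $ i = (if i = k then d x else x $ i)" for x i
  proof (cases "i = k")
    case True
    then show ?thesis by (simp add: D_def matrix_vector_mult_def covector_expansion[OF d, of x])
  next
    case False
    then have "(D *v x) $ i = (mat 1 *v x) $ i" by (simp add: D_def matrix_vector_mult_def)
    then show ?thesis using False by simp
  qed
  \<comment> \<open>\<open>D\<close> is invertible: a kernel vector has at most a
    \<open>k\<close>-th coordinate, and \<open>d (axis k 1)\<close> is nonzero.\<close>
  have "x = 0" if "D *v x = 0" for x
  proof -
    have 0: "x $ i = 0" if "i \<noteq> k" for i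
      using D[of x i] that \<open>D *v x = 0\<close> by simp
    then have "d x = d (axis k 1) * x $ k"
      by (subst covector_expansion[OF d], subst sum.remove[of _ k]) auto
    then have "x $ k = 0" using D[of x k] that k by simp
    with 0 show ?thesis by (metis vec_eq_iff zero_index)
  qed
  then obtain A where "A ** D = mat 1" using matrix_left_invertible_ker[of D] by blast
  then have A: "D ** A = mat 1" "A ** D = mat 1" using matrix_left_right_inverse by blast+
  have "det A \<noteq> 0" using A(1) by (metis det_I det_mul mult_zero_right zero_neq_one)
  have dA: "d (A *v y) = y $ k" for y
    using D[of "A *v y" k] A(1) by (simp add: matrix_vector_mul_assoc)
  define x where "x = D *v (s *v (A *v axis k 1))"
  have Ax: "A *v x = s *v (A *v axis k 1)"
    using A(2) by (simp add: x_def matrix_vector_mul_assoc matrix_mul_assoc)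
  have "(s ** A) $ i $ j = (if j = k then (A *v x) $ i else A $ i $ j)" for i j
  proof -
    have "(s ** A) $ i $ j = (s *v (A *v axis j 1)) $ i"
      by (simp add: matrix_vector_mul_assoc matrix_vector_mult_axis)
    moreover have "s *v (A *v axis j 1) = A *v axis j 1" if "j \<noteq> k"
      using that by (simp add: s dA axis_def)
    ultimately show ?thesis by (auto simp: Ax matrix_vector_mult_axis)
  qed
  then have "s ** A = (\<chi> i j. if j = k then (A *v x) $ i else A $ i $ j)"
    by (simp add: vec_eq_iff)
  \<comment> \<open>Column \<open>k\<close> of \<open>A\<close> has been replaced by
    \<open>A *v x\<close>, which is the situation of \<open>cramer_lemma\<close>.\<close>
  then have "det s * det A = x $ k * det A"
    by (simp add: cramer_lemma flip: det_mul)
  moreover have "x $ k = 1 - d u"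
    using D[of "s *v (A *v axis k 1)" k] by (simp add: x_def s covector_diff[OF d] covector_scale[OF d] dA)
  ultimately show ?thesis using \<open>det A \<noteq> 0\<close> by simp
qed

section \<open>Inverses, powers and finite groups of matrices\<close>

lemma matrix_inv_cancel:
  assumes "invertible (A :: complex^'n^'n)"
  shows "matrix_inv A ** A = mat 1" "A ** matrix_inv A = mat 1"
proof -
  have "A ** matrix_inv A = mat 1 \<and> matrix_inv A ** A = mat 1"
    using assms unfolding invertible_def matrix_inv_def by (rule someI_ex)
  then show "matrix_inv A ** A = mat 1" "A ** matrix_inv A = mat 1" by auto
qed

lemma matrix_inv_eqI:
  fixes A B :: "complex^'n^'n"
  assumes "B ** A = mat 1"
  shows "matrix_inv A = B"
proof -
  have "invertible A" using assms invertible_left_inverse by blast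
  then have "B ** (A ** matrix_inv A) = B" by (simp add: matrix_inv_cancel)
  then show ?thesis using assms by (simp add: matrix_mul_assoc)
qed

lemma mat_power_0: "mat_power A 0 = mat 1"
  and mat_power_Suc: "mat_power A (Suc i) = A ** mat_power A i"
  by (simp_all add: mat_power_def)

lemma det_mat_power: "det (mat_power A i) = det A ^ i"
  by (induction i) (simp_all add: mat_power_0 mat_power_Suc det_mul)

text \<open>The axioms speak of \<open>**\<close> and \<open>matrix_inv\<close> directly, so that
  the same facts serve the full group, its pointwise stabilizers and the direct factors.\<close>

locale finite_linear_group =
  fixes G :: "(complex^'n^'n) set"
  assumes finite_group: "finite G"
    and one: "mat 1 \<in> G"
    and mult: "g \<in> G \<Longrightarrow> h \<in> G \<Longrightarrow> g ** h \<in> G"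
    and inv: "g \<in> G \<Longrightarrow> matrix_inv g \<in> G"
    and invertible: "g \<in> G \<Longrightarrow> invertible g"
begin

lemma inv_mult: "g \<in> G \<Longrightarrow> matrix_inv g ** g = mat 1"
  and mult_inv: "g \<in> G \<Longrightarrow> g ** matrix_inv g = mat 1"
  using matrix_inv_cancel invertible by auto

lemma inv_mult_vec: "g \<in> G \<Longrightarrow> matrix_inv g *v (g *v x) = x"
  and mult_inv_vec: "g \<in> G \<Longrightarrow> g *v (matrix_inv g *v x) = x"
  by (simp_all add: matrix_vector_mul_assoc inv_mult mult_inv)

lemma inv_inv: "g \<in> G \<Longrightarrow> matrix_inv (matrix_inv g) = g"
  by (simp add: matrix_inv_eqI mult_inv)

lemma bij_betw_left_mult: "h \<in> G \<Longrightarrow> bij_betw (\<lambda>g. h ** g) G G"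
  by (rule bij_betw_byWitness[where f' = "\<lambda>g. matrix_inv h ** g"])
    (auto simp: matrix_mul_assoc inv_mult mult_inv mult inv)

lemma bij_betw_right_mult: "h \<in> G \<Longrightarrow> bij_betw (\<lambda>g. g ** h) G G"
  by (rule bij_betw_byWitness[where f' = "\<lambda>g. g ** matrix_inv h"])
    (auto simp: inv_mult mult_inv mult inv simp flip: matrix_mul_assoc)

lemma bij_betw_conj: "h \<in> G \<Longrightarrow> bij_betw (\<lambda>g. h ** g ** matrix_inv h) G G"
  using bij_betw_trans[OF bij_betw_left_mult[of h] bij_betw_right_mult[of "matrix_inv h"]]
  by (simp add: inv o_def)

lemma card_pos: "card G > 0"
  using finite_group one by (auto simp: card_gt_0_iff)

lemma mat_power_closed: "g \<in> G \<Longrightarrow> mat_power g i \<in> G"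
  by (induction i) (simp_all add: mat_power_0 mat_power_Suc one mult)

lemma fixes_inv: "g \<in> G \<Longrightarrow> g *v x = x \<Longrightarrow> matrix_inv g *v x = x"
  by (metis inv_mult_vec)

lemma det_nonzero: "g \<in> G \<Longrightarrow> det g \<noteq> 0"
  by (metis det_I det_mul inv_mult mult_zero_right zero_neq_one)

text \<open>Left multiplication by \<open>g\<close> permutes the group, so the nonzero product of
  all determinants equals itself times \<open>det g ^ card G\<close>.\<close>

lemma det_power_card:
  assumes "g \<in> G"
  shows "det g ^ card G = 1"
proof -
  have "(\<Prod>h\<in>G. det h) = (\<Prod>h\<in>G. det (g ** h))"
    by (rule prod.reindex_bij_betw[OF bij_betw_left_mult[OF assms], symmetric])
  also have "\<dots> = det g ^ card G * (\<Prod>h\<in>G. det h)"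
    by (simp add: det_mul prod.distrib)
  finally show ?thesis using det_nonzero finite_group by simp
qed

lemma pw_stabilizer_group: "finite_linear_group (pw_stabilizer G U)"
proof
  show "finite (pw_stabilizer G U)" using finite_group by (simp add: pw_stabilizer_def)
  show "matrix_inv g \<in> pw_stabilizer G U" if "g \<in> pw_stabilizer G U" for g
    using that by (simp add: pw_stabilizer_def inv fixes_inv)
qed (auto simp: pw_stabilizer_def one mult invertible simp flip: matrix_vector_mul_assoc)

text \<open>The \<open>i\<close>-th power of this transvection subtracts \<open>i\<close> times
  \<open>d x *s u\<close>. Two powers coincide in a finite group, and characteristic 0 then forces
  \<open>d x *s u = 0\<close>.\<close>

lemma unipotent_trivial:
  assumes g: "g \<in> G" and d: "d u = 0" "d \<in> covectors" and eq: "\<And>x. g *v x = x - d x *s u"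
  shows "g = mat 1"
proof -
  have pow: "mat_power g i *v x = x - (of_nat i * d x) *s u" for i x
  proof (induction i)
    case (Suc i)
    have "mat_power g (Suc i) *v x = g *v (mat_power g i *v x)"
      by (simp add: mat_power_Suc matrix_vector_mul_assoc)
    also have "\<dots> = x - (of_nat (Suc i) * d x) *s u"
      by (simp add: Suc eq covector_diff[OF d(2)] covector_scale[OF d(2)] d(1) vec.scale_left_distrib algebra_simps)
    finally show ?case .
  qed (simp add: mat_power_0)
  have "\<not> inj (mat_power g)"
    using finite_group mat_power_closed[OF g] by (metis finite_imageD finite_subset image_subset_iff infinite_UNIV_nat)
  then obtain i j where ij: "i \<noteq> j" "mat_power g i = mat_power g j"
    by (auto simp: inj_def)
  have "d x *s u = 0" for x
  proof -
    have "(of_nat i * d x) *s u = (of_nat j * d x) *s u"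
      using pow[of i x] pow[of j x] ij(2) by auto
    then have "(of_nat i - of_nat j :: complex) *s (d x *s u) = 0"
      by (auto simp: vec.scale_left_diff_distrib algebra_simps)
    then show ?thesis using ij(1) by (metis eq_iff_diff_eq_0 of_nat_eq_iff vec.scale_eq_0_iff)
  qed
  then show ?thesis by (simp add: matrix_eq eq)
qed

section \<open>Reflections with a given hyperplane\<close>

lemma reflection_hyperplane:
  assumes "H \<in> hyperplanes G"
  shows "vec.subspace H" "vec.dim H + 1 = CARD('n)"
  using assms subspace_fixed_space by (auto simp: hyperplanes_def reflections_def)

lemma hyperplane_covector:
  assumes "H \<in> hyperplanes G"
  obtains d where "d \<in> covectors" "d \<noteq> (\<lambda>v. 0)" "\<forall>v\<in>H. d v = 0"
proof -
  have "H \<noteq> UNIV"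
    using reflection_hyperplane(2)[OF assms] vec_dim_card[where 'a = complex and 'n = 'n] by auto
  then obtain v where "v \<notin> H" by blast
  then obtain f where "f \<in> covectors" "\<And>x. x \<in> H \<Longrightarrow> f x = 0" "f v \<noteq> 0"
    using separating_covector[OF reflection_hyperplane(1)[OF assms]] by metis
  then show ?thesis by (intro that[of f]) auto
qed

text \<open>An element fixing \<open>H\<close> pointwise has the form \<open>x - d x *s u\<close>;
  if it is not the identity, then \<open>u\<close> is nonzero and its fixed space is exactly the
  kernel of \<open>d\<close>, which is \<open>H\<close>.\<close>

lemma pw_stabilizer_hyperplane:
  assumes H: "H \<in> hyperplanes G"
  shows "{s \<in> reflections G. fixed_space s = H} = pw_stabilizer G H - {mat 1}"
proof -
  have "s \<in> reflections G \<and> fixed_space s = H" if s: "s \<in> pw_stabilizer G H" "s \<noteq> mat 1" for s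
  proof -
    obtain d where d: "d \<in> covectors" "d \<noteq> (\<lambda>v. 0)" "\<forall>v\<in>H. d v = 0"
      using hyperplane_covector[OF H] by blast
    obtain u where u: "\<And>x. s *v x = x - d x *s u"
      using fixes_hyperplane_form[OF reflection_hyperplane[OF H] d] s(1)
      by (auto simp: pw_stabilizer_def)
    have "u \<noteq> 0" using s(2) u by (auto simp: matrix_eq)
    then have "fixed_space s = {x. d x = 0}" by (auto simp: fixed_space_def u)
    then have "fixed_space s = H"
      using hyperplane_eq_kernel[OF reflection_hyperplane[OF H] d] by auto
    then show ?thesis
      using s(1) reflection_hyperplane(2)[OF H] by (simp add: reflections_def pw_stabilizer_def)
  qed
  moreover have "mat 1 \<notin> reflections G"
    using vec_dim_card[where 'a = complex and 'n = 'n]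
    by (simp add: reflections_def fixed_space_def)
  ultimately show ?thesis
    by (auto simp: pw_stabilizer_def reflections_def fixed_space_def)
qed

text \<open>The quotient of two elements with equal determinant has \<open>d u = 0\<close> by the
  rank-one determinant formula, so it is a transvection of finite order and hence trivial.\<close>

lemma inj_on_det_pw_stabilizer:
  assumes H: "H \<in> hyperplanes G"
  shows "inj_on det (pw_stabilizer G H)"
proof
  interpret S: finite_linear_group "pw_stabilizer G H" by (rule pw_stabilizer_group)
  obtain d where d: "d \<in> covectors" "d \<noteq> (\<lambda>v. 0)" "\<forall>v\<in>H. d v = 0"
    using hyperplane_covector[OF H] by blast
  fix s t assume st: "s \<in> pw_stabilizer G H" "t \<in> pw_stabilizer G H" "det s = det t"
  define r where "r = matrix_inv t ** s"
  have r: "r \<in> pw_stabilizer G H" using st by (simp add: r_def S.mult S.inv)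
  have "det r * det t = det t"
    using st S.mult_inv[of t] by (metis S.inv_mult det_I det_mul mult.commute mult.left_commute mult.right_neutral r_def)
  then have "det r = 1" using S.det_nonzero st(2) by simp
  obtain u where u: "\<And>x. r *v x = x - d x *s u"
    using fixes_hyperplane_form[OF reflection_hyperplane[OF H] d, of r] r
    by (auto simp: pw_stabilizer_def)
  then have "r = mat 1"
    using S.unipotent_trivial[OF r _ d(1) u] det_rank_one_update[OF d(1) u] \<open>det r = 1\<close> by simp
  then have "t ** (matrix_inv t ** s) = t" by (simp add: r_def)
  then show "s = t" using st by (simp add: matrix_mul_assoc S.mult_inv)
qed

text \<open>The determinant identifies the stabilizer with the \<open>m\<close>-th roots of unity,
  and the powers of the generator run through them.\<close>

lemma bij_betw_refl_elt:
  assumes H: "H \<in> hyperplanes G"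
  shows "bij_betw (refl_elt G H) {1..refl_order G H - 1} {s \<in> reflections G. fixed_space s = H}"
proof -
  let ?S = "pw_stabilizer G H"
  interpret S: finite_linear_group ?S by (rule pw_stabilizer_group)
  define m where "m = refl_order G H"
  have m: "m = card ?S" "1 \<le> m" using S.card_pos by (auto simp: m_def refl_order_def)
  define \<zeta> where "\<zeta> = exp (2 * of_real pi * \<i> / of_nat m)"
  have \<zeta>: "\<zeta> ^ j = exp (2 * of_real pi * \<i> * of_nat j / of_nat m)" for j
    by (simp add: \<zeta>_def algebra_simps flip: exp_of_nat_mult)
  have inj: "inj_on det ?S" using H by (rule inj_on_det_pw_stabilizer)
  \<comment> \<open>Injectivity gives \<open>m\<close> distinct values among the \<open>m\<close>
    roots, hence all of them.\<close>
  have det: "det ` ?S = {z. z ^ m = 1}"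
  proof (rule card_subset_eq)
    show "finite {z::complex. z ^ m = 1}" using m(2) by (rule finite_roots_unity)
    show "det ` ?S \<subseteq> {z. z ^ m = 1}" using S.det_power_card m(1) by auto
    show "card (det ` ?S) = card {z::complex. z ^ m = 1}"
      using m by (simp add: card_image[OF inj] card_roots_unity_eq)
  qed
  have "\<zeta> \<in> {z. z ^ m = 1}" using complex_root_unity[of m 1] m(2) by (simp add: \<zeta>_def)
  then obtain s where s: "s \<in> ?S" "det s = \<zeta>" using det by (metis imageE)
  \<comment> \<open>The definite description in \<open>refl_gen\<close> is meaningful: existence is
    surjectivity, uniqueness is injectivity.\<close>
  have "\<exists>!s. s \<in> ?S \<and> det s = \<zeta>"
    using s inj by (auto intro!: ex1I[of _ s] dest: inj_onD)
  from theI'[OF this] have gen: "refl_gen G H \<in> ?S" "det (refl_gen G H) = \<zeta>"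
    by (simp_all add: refl_gen_def \<zeta>_def m_def)
  have elt: "refl_elt G H i \<in> ?S" for i
    unfolding refl_elt_def using gen(1) by (rule S.mat_power_closed)
  have "bij_betw (det \<circ> refl_elt G H) {..<m} {z. z ^ m = 1}"
    using Complex_Transcendental.bij_betw_roots_unity[of m] m(2)
    by (simp add: o_def refl_elt_def det_mat_power gen(2) \<zeta> complex_roots_unity)
  moreover have "bij_betw det ?S {z. z ^ m = 1}" using inj det by (simp add: bij_betw_def)
  ultimately have "bij_betw (refl_elt G H) {..<m} ?S"
    using elt bij_betw_comp_iff2[of det ?S "{z. z ^ m = 1}" "refl_elt G H" "{..<m}"] by blast
  moreover have "refl_elt G H 0 = mat 1" by (simp add: refl_elt_def mat_power_0)
  \<comment> \<open>Exponent 0 gives the identity; removing it leaves the exponents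
    \<open>1..m - 1\<close> and exactly the reflections.\<close>
  ultimately have "bij_betw (refl_elt G H) ({..<m} - {0}) (?S - {mat 1})"
    using m(2) by (metis bij_betw_DiffI bij_betw_singletonI empty_subsetI insert_subset S.one lessThan_iff less_le_trans zero_less_one)
  moreover have "{..<m} - {0} = {1..m - 1}" using m(2) by auto
  ultimately show ?thesis by (simp only: pw_stabilizer_hyperplane[OF H] m_def)
qed

lemma finite_reflections: "finite (reflections G)"
  using finite_group by (simp add: reflections_def)

lemma finite_hyperplanes: "finite (hyperplanes G)"
  using finite_reflections by (simp add: hyperplanes_def)

lemma sum_refl_elt:
  "H \<in> hyperplanes G \<Longrightarrow>
    (\<Sum>i=1..refl_order G H - 1. F (refl_elt G H i)) = (\<Sum>s | s \<in> reflections G \<and> fixed_space s = H. F s)"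
  by (rule sum.reindex_bij_betw[OF bij_betw_refl_elt])

lemma sum_over_hyperplanes:
  fixes F :: "complex^'n^'n \<Rightarrow> complex"
  shows "(\<Sum>H\<in>hyperplanes G. \<Sum>s | s \<in> reflections G \<and> fixed_space s = H. F s) = sum F (reflections G)"
  by (rule sum.group[OF finite_reflections finite_hyperplanes]) (auto simp: hyperplanes_def)

end

section \<open>Schur's lemma and the scalars h\<close>

text \<open>The vector p(A)v. Evaluating at one vector lets a single orbit
  \<open>v, A v, A (A v), ...\<close> carry the argument.\<close>

definition apply_poly :: "(complex^'n \<Rightarrow> complex^'n) \<Rightarrow> complex poly \<Rightarrow> complex^'n \<Rightarrow> complex^'n" where
  "apply_poly A p v = (\<Sum>i\<le>degree p. coeff p i *s (A ^^ i) v)"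

lemma apply_poly_bound:
  "degree p \<le> n \<Longrightarrow> apply_poly A p v = (\<Sum>i\<le>n. coeff p i *s (A ^^ i) v)"
  unfolding apply_poly_def by (rule sum.mono_neutral_left) (auto simp: coeff_eq_0)

lemma apply_poly_pCons: "apply_poly A (pCons c q) v = c *s v + apply_poly A q (A v)"
proof -
  have "apply_poly A (pCons c q) v = (\<Sum>i\<le>Suc (degree q). coeff (pCons c q) i *s (A ^^ i) v)"
    by (rule apply_poly_bound) (rule degree_pCons_le)
  also have "\<dots> = c *s v + apply_poly A q (A v)"
    by (subst sum.atMost_Suc_shift) (simp add: apply_poly_def funpow_swap1)
  finally show ?thesis .
qed

lemma apply_poly_add: "apply_poly A (p + q) v = apply_poly A p v + apply_poly A q v"
  using degree_add_le_max[of p q]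
  by (simp add: apply_poly_bound[where n = "max (degree p) (degree q)"] vec.scale_left_distrib sum.distrib)

lemma apply_poly_smult: "apply_poly A (smult c p) v = c *s apply_poly A p v"
  by (simp add: apply_poly_bound[OF degree_smult_le] apply_poly_def vec.scale_sum_right)

text \<open>Splitting off a root z gives p(A)v = q(A)w with w = (A - z)v. Either \<open>w\<close> is
  zero and \<open>v\<close> is an eigenvector, or \<open>w\<close> continues the induction with the
  polynomial \<open>q\<close> of smaller degree.\<close>

lemma eigenvector_if_annihilated:
  fixes A :: "complex^'n \<Rightarrow> complex^'n"
  assumes A: "Vector_Spaces.linear (*s) (*s) A" and U: "vec.subspace U" "\<And>v. v \<in> U \<Longrightarrow> A v \<in> U"
  shows "p \<noteq> 0 \<Longrightarrow> v \<in> U \<Longrightarrow> v \<noteq> 0 \<Longrightarrow> apply_poly A p v = 0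
    \<Longrightarrow> \<exists>c v. v \<in> U \<and> v \<noteq> 0 \<and> A v = c *s v"
proof (induction "degree p" arbitrary: p v)
  case 0
  then obtain c where "p = [:c:]" using degree_eq_zeroE by metis
  with 0 show ?case by (simp add: apply_poly_def)
next
  case (Suc n)
  have lin: "(A ^^ i) (x - c *s y) = (A ^^ i) x - c *s (A ^^ i) y" for i x c y
  proof (induction i)
    case (Suc i)
    have "A (x - c *s y) = A x - c *s A y" for x y
      using A by (metis vec.linear_diff vec.linear_scale)
    then show ?case using Suc by simp
  qed simp
  obtain z where "poly p z = 0"
    using fundamental_theorem_of_algebra[of p] Suc.hyps(2) constant_degree by (metis nat.simps(3))
  then obtain q where q: "p = [:-z, 1:] * q" using poly_eq_0_iff_dvd by (metis dvdE)
  with Suc.prems have "q \<noteq> 0" by auto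
  then have "degree p = degree [:-z, 1:] + degree q" unfolding q by (intro degree_mult_eq) auto
  then have deg: "n = degree q" using Suc.hyps(2) by simp
  define w where "w = A v - z *s v"
  have "p = pCons 0 q + smult (- z) q" by (simp add: q)
  then have "apply_poly A p v = apply_poly A q (A v) - z *s apply_poly A q v"
    by (simp only: apply_poly_add apply_poly_smult apply_poly_pCons) simp
  also have "\<dots> = apply_poly A q w"
    by (simp add: w_def apply_poly_def lin vec.scale_right_diff_distrib sum_subtractf vec.scale_sum_right mult.commute)
  finally have "apply_poly A q w = 0" using Suc.prems by simp
  moreover have "w \<in> U" using Suc.prems U by (simp add: w_def vec.subspace_diff vec.subspace_scale)
  ultimately show ?case
  proof (cases "w = 0")
    case True
    then show ?thesis using Suc.prems unfolding w_def by (metis eq_iff_diff_eq_0)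
  next
    case False
    then show ?thesis using Suc.hyps(1)[OF deg \<open>q \<noteq> 0\<close> \<open>w \<in> U\<close> _ \<open>apply_poly A q w = 0\<close>] by blast
  qed
qed

text \<open>The first n + 1 orbit vectors in an n-dimensional space satisfy a nontrivial linear
  relation, whose coefficients form the polynomial.\<close>

lemma annihilating_polynomial:
  fixes A :: "complex^'n \<Rightarrow> complex^'n"
  obtains p where "p \<noteq> 0" "apply_poly A p v = 0"
proof -
  let ?n = "CARD('n)" and ?f = "\<lambda>i. (A ^^ i) v"
  have "\<exists>c. (\<exists>i\<le>?n. c i \<noteq> 0) \<and> (\<Sum>i\<le>?n. c i *s ?f i) = 0"
  proof (cases "inj_on ?f {..?n}")
    case True
    have "card (?f ` {..?n}) = Suc ?n" using True by (simp add: card_image)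
    moreover have "vec.dim (?f ` {..?n}) \<le> ?n" by (rule dim_subset_UNIV_cart_gen)
    ultimately have "vec.dependent (?f ` {..?n})"
      using vec.independent_bound_general[of "?f ` {..?n}"] by linarith
    then obtain u where u: "\<exists>x\<in>?f ` {..?n}. u x \<noteq> 0" "(\<Sum>x\<in>?f ` {..?n}. u x *s x) = 0"
      by (auto simp: vec.dependent_finite)
    then show ?thesis
      using sum.reindex[OF True, of "\<lambda>x. u x *s x"]
      by (intro exI[of _ "\<lambda>i. u (?f i)"]) auto
  next
    case False
    then obtain i j where ij: "i \<noteq> j" "i \<le> ?n" "j \<le> ?n" "?f i = ?f j" by (auto simp: inj_on_def)
    \<comment> \<open>Linear dependence is a notion for sets, so a repeated orbit vector needs its
      own relation, with coefficient 1 at \<open>i\<close> and -1 at \<open>j\<close>.\<close>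
    let ?c = "\<lambda>k. (if k = i then 1 else 0) - (if k = j then 1 else 0 :: complex)"
    have "(\<Sum>k\<le>?n. ?c k *s ?f k) = (\<Sum>k\<le>?n. (if k = i then ?f i else 0)) - (\<Sum>k\<le>?n. (if k = j then ?f j else 0))"
      by (subst sum_subtractf[symmetric], rule sum.cong) auto
    then have "(\<Sum>k\<le>?n. ?c k *s ?f k) = 0" using ij by simp
    moreover have "?c i \<noteq> 0" using ij by simp
    ultimately show ?thesis using ij(2) by (intro exI[of _ ?c]) blast
  qed
  then obtain c i where c: "i \<le> ?n" "c i \<noteq> 0" "(\<Sum>i\<le>?n. c i *s ?f i) = 0" by blast
  define p where "p = (\<Sum>i\<le>?n. monom (c i) i)"
  have coeff: "coeff p k = (if k \<le> ?n then c k else 0)" for k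
    by (simp add: p_def coeff_sum coeff_monom)
  have "degree p \<le> ?n" by (rule degree_le) (simp add: coeff)
  then have "apply_poly A p v = 0" using c(3) by (simp add: apply_poly_bound coeff)
  moreover have "p \<noteq> 0" using coeff[of i] c by auto
  ultimately show ?thesis using that by blast
qed

lemma eigenvector_in_invariant_subspace:
  fixes A :: "complex^'n \<Rightarrow> complex^'n"
  assumes A: "Vector_Spaces.linear (*s) (*s) A"
    and U: "vec.subspace U" "U \<noteq> {0}" "\<And>v. v \<in> U \<Longrightarrow> A v \<in> U"
  obtains c v where "v \<in> U" "v \<noteq> 0" "A v = c *s v"
proof -
  obtain v where "v \<in> U" "v \<noteq> 0" using U vec.subspace_0 by blast
  moreover obtain p where "p \<noteq> 0" "apply_poly A p v = 0" using annihilating_polynomial .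
  ultimately show ?thesis using eigenvector_if_annihilated[OF A U(1,3)] that by blast
qed

text \<open>An eigenspace of \<open>A\<close> inside \<open>U\<close> is stable under
  \<open>G\<close> because \<open>A\<close> commutes with \<open>G\<close>; being nonzero, it is all
  of \<open>U\<close> by irreducibility.\<close>

lemma schur:
  fixes A :: "complex^'n \<Rightarrow> complex^'n"
  assumes A: "Vector_Spaces.linear (*s) (*s) A"
    and irr: "irreducible_on G U" and AU: "\<And>v. v \<in> U \<Longrightarrow> A v \<in> U"
    and comm: "\<And>g v. g \<in> G \<Longrightarrow> A (g *v v) = g *v A v"
  obtains c where "\<And>v. v \<in> U \<Longrightarrow> A v = c *s v"
proof -
  have U: "vec.subspace U" "U \<noteq> {0}" "\<And>g v. g \<in> G \<Longrightarrow> v \<in> U \<Longrightarrow> g *v v \<in> U"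
    and min: "\<And>X. vec.subspace X \<Longrightarrow> X \<subseteq> U \<Longrightarrow> (\<forall>g\<in>G. \<forall>v\<in>X. g *v v \<in> X) \<Longrightarrow> X = {0} \<or> X = U"
    using irr unfolding irreducible_on_def by blast+
  obtain c v where v: "v \<in> U" "v \<noteq> 0" "A v = c *s v"
    using eigenvector_in_invariant_subspace[OF A U(1,2) AU] by blast
  define X where "X = {x \<in> U. A x = c *s x}"
  have "vec.subspace X"
    using U(1) unfolding X_def vec.subspace_def
    by (auto simp: vec.linear_0[OF A] vec.linear_add[OF A] vec.linear_scale[OF A] vec.scale_right_distrib mult.commute)
  moreover have "\<forall>g\<in>G. \<forall>x\<in>X. g *v x \<in> X"
    by (auto simp: X_def U(3) comm vector_scalar_commute)
  moreover have "X \<subseteq> U" "X \<noteq> {0}" using v by (auto simp: X_def)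
  ultimately have "X = U" using min by blast
  then show ?thesis using that X_def by blast
qed

text \<open>The inverse appears because \<open>act s f = f \<circ> s\<inverse>\<close>: this operator is dual to the sum of
  \<open>a s (1 - s)\<close> on covectors.\<close>

definition refl_op :: "(complex^'n^'n) set \<Rightarrow> (complex^'n^'n \<Rightarrow> complex) \<Rightarrow> complex^'n \<Rightarrow> complex^'n" where
  "refl_op S a v = (\<Sum>s\<in>S. a s *s (v - matrix_inv s *v v))"

lemma linear_refl_op: "Vector_Spaces.linear (*s) (*s) (refl_op S a)"
  unfolding Vector_Spaces.linear_iff
  by (auto simp: vec.vector_space_axioms refl_op_def matrix_vector_right_distrib vector_scalar_commute vec.scale_sum_right
      vec.scale_right_distrib vec.scale_right_diff_distrib mult.commute algebra_simps simp flip: sum.distrib)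

lemma covector_refl_op:
  "f \<in> covectors \<Longrightarrow> f (refl_op S a v) = (\<Sum>s\<in>S. a s * (f v - f (matrix_inv s *v v)))"
  by (simp add: refl_op_def covector_sum covector_scale covector_diff right_diff_distrib)

section \<open>Conjugation, averaging and the reflection representation\<close>

context finite_linear_group
begin

lemma fixed_space_conj:
  assumes "g \<in> G"
  shows "fixed_space (g ** s ** matrix_inv g) = (*v) g ` fixed_space s"
proof
  show "(*v) g ` fixed_space s \<subseteq> fixed_space (g ** s ** matrix_inv g)"
    using assms by (auto simp: fixed_space_def inv_mult_vec simp flip: matrix_vector_mul_assoc)
  show "fixed_space (g ** s ** matrix_inv g) \<subseteq> (*v) g ` fixed_space s"
  proof
    fix x assume "x \<in> fixed_space (g ** s ** matrix_inv g)"
    then have "g *v (s *v (matrix_inv g *v x)) = x"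
      by (simp add: fixed_space_def matrix_vector_mul_assoc matrix_mul_assoc)
    then have "s *v (matrix_inv g *v x) = matrix_inv g *v x"
      using inv_mult_vec[OF assms] by metis
    then show "x \<in> (*v) g ` fixed_space s"
      using mult_inv_vec[OF assms, of x] unfolding fixed_space_def by (metis (mono_tags) image_eqI mem_Collect_eq)
  qed
qed

lemma inj_vec: "g \<in> G \<Longrightarrow> inj ((*v) g)"
  by (metis inj_def inv_mult_vec)

lemma dim_image: "g \<in> G \<Longrightarrow> vec.dim ((*v) g ` U) = vec.dim U"
  by (rule vec.dim_image_eq) (auto intro: matrix_vector_mul_linear_gen inj_on_subset[OF inj_vec])

lemma reflections_conj: "g \<in> G \<Longrightarrow> s \<in> reflections G \<Longrightarrow> g ** s ** matrix_inv g \<in> reflections G"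
  by (simp add: reflections_def fixed_space_conj dim_image mult inv)

lemma inj_on_conj: "g \<in> G \<Longrightarrow> S \<subseteq> G \<Longrightarrow> inj_on (\<lambda>s. g ** s ** matrix_inv g) S"
  using bij_betw_conj[of g] by (auto simp: bij_betw_def intro: inj_on_subset)

lemma image_conj_reflections:
  "g \<in> G \<Longrightarrow> (\<lambda>s. g ** s ** matrix_inv g) ` reflections G = reflections G"
  using reflections_conj[of g] inj_on_conj[of g "reflections G"]
  by (intro endo_inj_surj[OF finite_reflections]) (auto simp: reflections_def[of G])

text \<open>Serves twice: for the set of all reflections it gives commutation with the group, and
  for those fixing \<open>L\<close> it carries the operator over to a translate of
  \<open>L\<close>.\<close>

lemma refl_op_conj:
  assumes g: "g \<in> G" and S: "S \<subseteq> G" and a: "\<And>s. s \<in> S \<Longrightarrow> a (g ** s ** matrix_inv g) = a s"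
  shows "g *v refl_op S a v = refl_op ((\<lambda>s. g ** s ** matrix_inv g) ` S) a (g *v v)"
proof -
  have inverse: "matrix_inv (g ** s ** matrix_inv g) = g ** matrix_inv s ** matrix_inv g" if "s \<in> S" for s
  proof (rule matrix_inv_eqI)
    have "g ** matrix_inv s ** matrix_inv g ** (g ** s ** matrix_inv g)
        = g ** (matrix_inv s ** ((matrix_inv g ** g) ** s)) ** matrix_inv g"
      by (simp only: matrix_mul_assoc)
    also have "\<dots> = mat 1"
      using that S g by (simp add: inv_mult mult_inv subset_iff)
    finally show "g ** matrix_inv s ** matrix_inv g ** (g ** s ** matrix_inv g) = mat 1" .
  qed
  have "refl_op ((\<lambda>s. g ** s ** matrix_inv g) ` S) a (g *v v)
      = (\<Sum>s\<in>S. a s *s (g *v v - g ** matrix_inv s ** matrix_inv g *v (g *v v)))"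
    unfolding refl_op_def sum.reindex[OF inj_on_conj[OF g S]] by (simp add: a inverse)
  also have "\<dots> = (\<Sum>s\<in>S. g *v (a s *s (v - matrix_inv s *v v)))"
    by (rule sum.cong) (simp_all add: vector_scalar_commute matrix_vector_mult_diff_distrib inv_mult_vec g flip: matrix_vector_mul_assoc)
  finally show ?thesis by (simp add: refl_op_def vec.sum)
qed

lemma refl_op_in_refl_rep: "S \<subseteq> G \<Longrightarrow> refl_op S a v \<in> refl_rep G"
  unfolding refl_op_def refl_rep_def
  by (intro vec.span_sum vec.span_scale vec.span_base) (auto intro: inv)

lemma group_sum_fixed: "h \<in> G \<Longrightarrow> h *v (\<Sum>g\<in>G. g *v v) = (\<Sum>g\<in>G. g *v v)"
  using sum.reindex_bij_betw[OF bij_betw_left_mult[of h], of "\<lambda>g. g *v v"]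
  by (simp add: vec.sum matrix_vector_mul_assoc)

text \<open>Right multiplication permutes the group, so the sum takes the same value at
  \<open>v\<close> and at \<open>g *v v\<close>.\<close>

lemma group_sum_refl_rep:
  assumes "v \<in> refl_rep G"
  shows "(\<Sum>g\<in>G. g *v v) = 0"
  using assms unfolding refl_rep_def
proof (rule vec.span_induct)
  show "vec.subspace {v. (\<Sum>g\<in>G. g *v v) = 0}"
    by (simp add: vec.subspace_def matrix_vector_right_distrib vector_scalar_commute sum.distrib flip: vec.scale_sum_right)
  show "(\<Sum>g\<in>G. g *v x) = 0" if x: "x \<in> {v - g *v v |g v. g \<in> G}" for x
  proof -
    obtain h w where h: "x = w - h *v w" "h \<in> G" using x by blast
    have "(\<Sum>g\<in>G. g *v (h *v w)) = (\<Sum>g\<in>G. g *v w)"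
      using sum.reindex_bij_betw[OF bij_betw_right_mult[OF h(2)], of "\<lambda>g. g *v w"]
      by (simp add: matrix_vector_mul_assoc)
    then show ?thesis by (simp add: h(1) matrix_vector_mult_diff_distrib sum_subtractf)
  qed
qed

text \<open>For a fixed \<open>v\<close> the sum over the group is \<open>card G\<close> times
  \<open>v\<close>, while on \<open>refl_rep G\<close> that sum is zero.\<close>

lemma refl_rep_fixed_trivial:
  assumes "v \<in> refl_rep G" "\<And>g. g \<in> G \<Longrightarrow> g *v v = v"
  shows "v = 0"
proof -
  have "(\<Sum>g\<in>G. g *v v) = (\<Sum>g\<in>G. v)"
    using assms(2) by (rule sum.cong[OF refl])
  then have "of_nat (card G) *s v = 0"
    unfolding vec.sum_constant_scale using group_sum_refl_rep[OF assms(1)] by simp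
  then show ?thesis using card_pos by (simp add: vec.scale_eq_0_iff)
qed

lemma refl_op_scalar:
  assumes "irreducible_on G (refl_rep G)"
    and "\<And>g s. g \<in> G \<Longrightarrow> s \<in> reflections G \<Longrightarrow> a (g ** s ** matrix_inv g) = a s"
  obtains c where "\<And>v. v \<in> refl_rep G \<Longrightarrow> refl_op (reflections G) a v = c *s v"
proof (rule schur[OF linear_refl_op assms(1)])
  have sub: "reflections G \<subseteq> G" by (auto simp: reflections_def)
  show "refl_op (reflections G) a v \<in> refl_rep G" for v
    by (rule refl_op_in_refl_rep[OF sub])
  show "refl_op (reflections G) a (g *v v) = g *v refl_op (reflections G) a v" if "g \<in> G" for g v
    using refl_op_conj[OF that sub, of a v] assms(2) that by (simp add: image_conj_reflections)
qed (use that in blast)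

text \<open>Paired with a covector \<open>f\<close>, the sum defining \<open>h_const\<close> becomes
  \<open>f\<close> of the reflection operator, so the scalar from Schur's lemma fits the
  description.\<close>

lemma h_const_refl_op:
  assumes irr: "irreducible_on G (refl_rep G)"
    and inv: "\<And>g s. g \<in> G \<Longrightarrow> s \<in> reflections G \<Longrightarrow> a (g ** s ** matrix_inv g) = a s"
    and \<beta>: "\<And>s f v. s \<in> reflections G \<Longrightarrow> f \<in> covectors \<Longrightarrow> act s f v = f v - f (\<gamma> s) * \<beta> s v"
    and v: "v \<in> refl_rep G"
  shows "refl_op (reflections G) a v = h_const G a \<beta> \<gamma> *s v"
proof -
  have sum: "(\<Sum>H\<in>hyperplanes G. \<Sum>i=1..refl_order G H - 1.
        a (refl_elt G H i) * \<beta> (refl_elt G H i) v * f (\<gamma> (refl_elt G H i)))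
      = f (refl_op (reflections G) a v)" if f: "f \<in> covectors" for f v
  proof -
    have "(\<Sum>H\<in>hyperplanes G. \<Sum>i=1..refl_order G H - 1.
        a (refl_elt G H i) * \<beta> (refl_elt G H i) v * f (\<gamma> (refl_elt G H i)))
      = (\<Sum>s\<in>reflections G. a s * \<beta> s v * f (\<gamma> s))"
      by (simp only: sum_refl_elt[where F = "\<lambda>s. a s * \<beta> s v * f (\<gamma> s)"] sum_over_hyperplanes cong: sum.cong)
    also have "\<dots> = f (refl_op (reflections G) a v)"
      unfolding covector_refl_op[OF f]
    proof (rule sum.cong)
      fix s assume "s \<in> reflections G"
      from \<beta>[OF this f, of v] show "a s * \<beta> s v * f (\<gamma> s) = a s * (f v - f (matrix_inv s *v v))"
        by (simp add: act_def)
    qed simp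
    finally show ?thesis .
  qed
  obtain c where c: "\<And>v. v \<in> refl_rep G \<Longrightarrow> refl_op (reflections G) a v = c *s v"
    using refl_op_scalar[OF irr inv] by metis
  \<comment> \<open>A nonzero vector with a nonzero coordinate makes the scalar unique, as the
    definite description demands.\<close>
  obtain u where u: "u \<in> refl_rep G" "u \<noteq> 0"
    using irr vec.subspace_0 unfolding irreducible_on_def by blast
  then obtain k where k: "u $ k \<noteq> 0" by (auto simp: vec_eq_iff)
  have "h_const G a \<beta> \<gamma> = c"
    unfolding h_const_def
  proof (rule the_equality)
    show "\<forall>f\<in>covectors. \<forall>v\<in>refl_rep G. (\<Sum>H\<in>hyperplanes G. \<Sum>i=1..refl_order G H - 1.
        a (refl_elt G H i) * \<beta> (refl_elt G H i) v * f (\<gamma> (refl_elt G H i))) = c * f v"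
    proof (intro ballI)
      fix f :: "complex^'n \<Rightarrow> complex" and v assume "f \<in> covectors" "v \<in> refl_rep G"
      then show "(\<Sum>H\<in>hyperplanes G. \<Sum>i=1..refl_order G H - 1.
        a (refl_elt G H i) * \<beta> (refl_elt G H i) v * f (\<gamma> (refl_elt G H i))) = c * f v"
        using sum[of f v] c[of v] covector_scale[of f c v] by simp
    qed
    fix h
    assume "\<forall>f\<in>covectors. \<forall>v\<in>refl_rep G. (\<Sum>H\<in>hyperplanes G. \<Sum>i=1..refl_order G H - 1.
        a (refl_elt G H i) * \<beta> (refl_elt G H i) v * f (\<gamma> (refl_elt G H i))) = h * f v"
    from bspec[OF bspec[OF this coordinate_covector[of k]] u(1)]
    have "(\<Sum>H\<in>hyperplanes G. \<Sum>i=1..refl_order G H - 1.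
        a (refl_elt G H i) * \<beta> (refl_elt G H i) u * (\<gamma> (refl_elt G H i)) $ k) = h * u $ k"
      by simp
    then have "c * u $ k = h * u $ k"
      using sum[OF coordinate_covector[of k], of u] c[OF u(1)] by auto
    then show "h = c" using k by simp
  qed
  then show ?thesis using c v by simp
qed

end

section \<open>Dunkl operators at points whose orbit is a zero set\<close>

context finite_linear_group
begin

text \<open>Every reflection in the sum fixes \<open>H\<close> pointwise, so the numerator vanishes
  on the kernel of \<open>d\<close> and exact division applies.\<close>

lemma dunkl_quotient:
  fixes a :: "complex^'n^'n \<Rightarrow> complex"
  assumes d: "d \<in> covectors" "d \<noteq> (\<lambda>v. 0)" "\<forall>v\<in>H. d v = 0"
    and H: "H \<in> hyperplanes G" and p: "p \<in> polynomials"
  defines "Q \<equiv> poly_quot (\<lambda>y. \<Sum>i=1..refl_order G H - 1.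
      a (refl_elt G H i) * (p y - act (refl_elt G H i) p y)) (d)"
  shows "Q \<in> polynomials"
    and "(\<Sum>s | s \<in> reflections G \<and> fixed_space s = H. a s * (p y - act s p y)) = d y * Q y"
proof -
  let ?R = "\<lambda>y. \<Sum>s | s \<in> reflections G \<and> fixed_space s = H. a s * (p y - act s p y)"
  have Q: "Q = poly_quot ?R (d)"
    unfolding Q_def by (simp only: sum_refl_elt[OF H, where F = "\<lambda>s. a s * (p _ - act s p _)"])
  have R: "?R \<in> polynomials"
    by (intro polynomials_sum polynomials_cmult polynomials_diff polynomials_act p)
  have R0: "?R x = 0" if "d x = 0" for x
  proof (rule sum.neutral, safe)
    fix s assume s: "s \<in> reflections G" "H = fixed_space s"
    have "x \<in> H" using that hyperplane_eq_kernel[OF reflection_hyperplane[OF H] d] by simp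
    then have "matrix_inv s *v x = x"
      using s fixes_inv[of s x] by (simp add: reflections_def fixed_space_def)
    then show "a s * (p x - act s p x) = 0" by (simp add: act_def)
  qed
  note spec = poly_quot_spec[where p = ?R, OF d(1,2) R R0]
  show "Q \<in> polynomials" unfolding Q by (rule spec(1))
  show "?R y = d y * Q y" unfolding Q by (rule spec(2))
qed

lemma dunkl_polynomial:
  assumes "\<forall>H\<in>hyperplanes G. \<alpha> H \<in> covectors \<and> \<alpha> H \<noteq> (\<lambda>v. 0) \<and> (\<forall>v\<in>H. \<alpha> H v = 0)"
    and "p \<in> polynomials"
  shows "dunkl G a \<alpha> \<xi> p \<in> polynomials"
  unfolding dunkl_def
  using assms by (intro polynomials_diff polynomials_sum polynomials_cmult dir_deriv_polynomial dunkl_quotient) auto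

text \<open>The hyperplanes are treated one at a time. If \<open>H\<close> misses \<open>x\<close>,
  the numerator is zero at \<open>x\<close> and the divisor is not, so the quotient vanishes there;
  if \<open>H\<close> contains \<open>x\<close>, the value of the quotient is recovered from a
  derivative.\<close>

lemma dunkl_at_orbit_zero:
  assumes \<alpha>: "\<forall>H\<in>hyperplanes G. \<alpha> H \<in> covectors \<and> \<alpha> H \<noteq> (\<lambda>v. 0) \<and> (\<forall>v\<in>H. \<alpha> H v = 0)"
    and p: "p \<in> polynomials" and zero: "\<And>g. g \<in> G \<Longrightarrow> p (g *v x) = 0"
    and f: "f \<in> covectors" "\<And>v. ((\<lambda>t. p (x + t *s v)) has_field_derivative f v) (at 0)"
  shows "dunkl G a \<alpha> \<xi> p x = f (\<xi> - refl_op {s \<in> reflections G. s *v x = x} a \<xi>)"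
proof -
  let ?Q = "\<lambda>H. poly_quot (\<lambda>y. \<Sum>i=1..refl_order G H - 1.
      a (refl_elt G H i) * (p y - act (refl_elt G H i) p y)) (\<alpha> H)"
  let ?D = "\<lambda>s. a s * (f \<xi> - f (matrix_inv s *v \<xi>))"
  have "\<alpha> H \<xi> * ?Q H x = (\<Sum>s | s \<in> reflections G \<and> fixed_space s = H. if s *v x = x then ?D s else 0)"
    if H: "H \<in> hyperplanes G" for H
  proof -
    have \<alpha>H: "\<alpha> H \<in> covectors" "\<alpha> H \<noteq> (\<lambda>v. 0)" "\<forall>v\<in>H. \<alpha> H v = 0" using \<alpha> H by auto
    note Q = dunkl_quotient[OF \<alpha>H H p, where a = a]
    have fix_iff: "s *v x = x \<longleftrightarrow> x \<in> H" if "fixed_space s = H" for s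
      using that by (auto simp: fixed_space_def)
    show ?thesis
    proof (cases "x \<in> H")
      case False
      have "?Q H x = 0"
      proof -
        have "(\<Sum>s | s \<in> reflections G \<and> fixed_space s = H. a s * (p x - act s p x)) = 0"
        proof (rule sum.neutral, safe)
          fix s assume "s \<in> reflections G"
          then have "p x = 0" "p (matrix_inv s *v x) = 0"
            using zero[of "mat 1"] zero[of "matrix_inv s"] by (auto simp: one inv reflections_def)
          then show "a s * (p x - act s p x) = 0" by (simp add: act_def)
        qed
        then show ?thesis
          using Q(2)[of x] False hyperplane_eq_kernel[OF reflection_hyperplane[OF H] \<alpha>H] by simp
      qed
      moreover have "(\<Sum>s | s \<in> reflections G \<and> fixed_space s = H. if s *v x = x then ?D s else 0) = 0"
        using False fix_iff by (intro sum.neutral) auto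
      ultimately show ?thesis by simp
    next
      case True
      \<comment> \<open>For \<open>x \<in> H\<close>, differentiate \<open>\<Sum> a\<^sub>s (p - s p) = \<alpha>\<^sub>H Q\<^sub>H\<close> at x in the direction \<open>\<xi>\<close>.\<close>
      then have \<alpha>x: "\<alpha> H x = 0" using \<alpha>H by blast
      define q where "q = ?Q H"
      obtain g where "g \<in> covectors"
          and g: "\<And>v. ((\<lambda>t. q (x + t *s v)) has_field_derivative g v) (at 0)"
        using polynomial_gradient[of q x] Q(1) q_def by blast
      have "((\<lambda>t. p (x + t *s \<xi>) - act s p (x + t *s \<xi>)) has_field_derivative
          f \<xi> - f (matrix_inv s *v \<xi>)) (at 0)" if "s \<in> reflections G" "fixed_space s = H" for s
      proof -
        have "matrix_inv s *v x = x"
          using that True fixes_inv[of s x] by (auto simp: reflections_def fixed_space_def)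
        \<comment> \<open>On a line through \<open>x\<close>, \<open>act s p\<close> is
          \<open>p\<close> on another line through the same point, so the one gradient
          \<open>f\<close> differentiates both terms.\<close>
        then have "act s p (x + t *s \<xi>) = p (x + t *s (matrix_inv s *v \<xi>))" for t
          by (simp add: act_def matrix_vector_right_distrib vector_scalar_commute)
        then show ?thesis using DERIV_diff[OF f(2) f(2)] by simp
      qed
      then have "((\<lambda>t. \<Sum>s | s \<in> reflections G \<and> fixed_space s = H.
          a s * (p (x + t *s \<xi>) - act s p (x + t *s \<xi>))) has_field_derivative
          (\<Sum>s | s \<in> reflections G \<and> fixed_space s = H. ?D s)) (at 0)"
        by (intro DERIV_sum DERIV_cmult) auto
      then have "((\<lambda>t. t * \<alpha> H \<xi> * ?Q H (x + t *s \<xi>)) has_field_derivative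
          (\<Sum>s | s \<in> reflections G \<and> fixed_space s = H. ?D s)) (at 0)"
        by (simp only: Q(2) covector_line[OF \<alpha>H(1)] \<alpha>x add_0)
      \<comment> \<open>In the product rule the term with the derivative of the quotient carries a
        factor \<open>t\<close> and drops out at 0.\<close>
      moreover have "((\<lambda>t. t * \<alpha> H \<xi> * ?Q H (x + t *s \<xi>)) has_field_derivative \<alpha> H \<xi> * ?Q H x) (at 0)"
        by (rule derivative_eq_intros refl g[unfolded q_def])+ simp
      ultimately have "\<alpha> H \<xi> * ?Q H x = (\<Sum>s | s \<in> reflections G \<and> fixed_space s = H. ?D s)"
        using DERIV_unique by blast
      also have "\<dots> = (\<Sum>s | s \<in> reflections G \<and> fixed_space s = H. if s *v x = x then ?D s else 0)"
        using True fix_iff by (intro sum.cong) auto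
      finally show ?thesis .
    qed
  qed
  then have "(\<Sum>H\<in>hyperplanes G. \<alpha> H \<xi> * ?Q H x) = (\<Sum>s\<in>reflections G. if s *v x = x then ?D s else 0)"
    by (simp add: sum_over_hyperplanes)
  also have "\<dots> = f (refl_op {s \<in> reflections G. s *v x = x} a \<xi>)"
    by (simp add: covector_refl_op f(1) sum.inter_filter finite_reflections)
  finally show ?thesis
    using f by (simp add: dunkl_def dir_deriv_def covector_diff DERIV_imp_deriv)
qed

section \<open>Parabolic subgroups and their fixed spaces\<close>

lemma reflections_pw_stabilizer:
  "reflections (pw_stabilizer G U) = {s \<in> reflections G. U \<subseteq> fixed_space s}"
  by (auto simp: reflections_def pw_stabilizer_def fixed_space_def)

lemma subspace_hyperplane_intersection:
  assumes "hyperplane_intersection G L"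
  shows "vec.subspace L"
proof -
  obtain B where B: "B \<subseteq> hyperplanes G" "L = \<Inter>B"
    using assms by (auto simp: hyperplane_intersection_def)
  then show ?thesis using reflection_hyperplane(1) by (auto intro!: vec.subspace_Inter)
qed

text \<open>Each hyperplane of the intersection is the fixed space of a reflection in the
  stabilizer, so a vector fixed by the stabilizer lies on all of them.\<close>

lemma fixed_by_pw_stabilizer:
  assumes "hyperplane_intersection G L" "\<And>g. g \<in> pw_stabilizer G L \<Longrightarrow> g *v v = v"
  shows "v \<in> L"
proof -
  obtain B where B: "B \<subseteq> hyperplanes G" "L = \<Inter>B"
    using assms by (auto simp: hyperplane_intersection_def)
  have "v \<in> H" if HB: "H \<in> B" for H
  proof -
    obtain s where "s \<in> reflections G" "H = fixed_space s"
      using HB B(1) unfolding hyperplanes_def by blast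
    moreover from this have "s \<in> pw_stabilizer G L"
      using HB B(2) by (auto simp: pw_stabilizer_def reflections_def fixed_space_def)
    ultimately show ?thesis using assms(2) by (auto simp: fixed_space_def)
  qed
  then show ?thesis using B by blast
qed

text \<open>The image of \<open>1 - s\<close> is a line.  As s moves the stable subspace \<open>refl_rep\<close>, this line lies in
  it, so \<open>1 - s\<close> maps M into \<open>M \<inter> refl_rep = 0\<close>.\<close>

lemma reflection_parabolic_dichotomy:
  assumes M: "hyperplane_intersection G M" and s: "s \<in> reflections G"
    and normal: "\<And>x. x \<in> pw_stabilizer G M \<Longrightarrow> s ** x ** matrix_inv s \<in> pw_stabilizer G M"
      "\<And>x. x \<in> pw_stabilizer G M \<Longrightarrow> matrix_inv s ** x ** s \<in> pw_stabilizer G M"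
    and moves: "v \<in> refl_rep (pw_stabilizer G M)" "s *v v \<noteq> v"
  shows "s \<in> pw_stabilizer G M"
proof -
  let ?P = "pw_stabilizer G M"
  interpret P: finite_linear_group ?P by (rule pw_stabilizer_group)
  have sG: "s \<in> G" using s by (simp add: reflections_def)
  have H: "fixed_space s \<in> hyperplanes G" using s by (simp add: hyperplanes_def)
  obtain d where d: "d \<in> covectors" "d \<noteq> (\<lambda>v. 0)" "\<forall>v\<in>fixed_space s. d v = 0"
    using hyperplane_covector[OF H] by blast
  obtain u where u: "\<And>x. s *v x = x - d x *s u"
    using fixes_hyperplane_form[OF reflection_hyperplane[OF H] d, of s] by (auto simp: fixed_space_def)
  have sub: "vec.subspace (refl_rep ?P)" by (simp add: refl_rep_def)
  have "s *v w \<in> refl_rep ?P" if "w \<in> refl_rep ?P" for w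
    using that unfolding refl_rep_def
  proof (rule vec.span_induct)
    show "vec.subspace {w. s *v w \<in> vec.span {v - g *v v |g v. g \<in> ?P}}"
      by (simp add: vec.subspace_def matrix_vector_right_distrib vector_scalar_commute vec.span_add vec.span_scale vec.span_zero)
    fix w assume "w \<in> {v - g *v v |g v. g \<in> ?P}"
    then obtain g y where g: "w = y - g *v y" "g \<in> ?P" by blast
    have "s *v w = s *v y - (s ** g ** matrix_inv s) *v (s *v y)"
      by (simp add: g(1) matrix_vector_mult_diff_distrib inv_mult_vec sG flip: matrix_vector_mul_assoc)
    then show "s *v w \<in> vec.span {v - g *v v |g v. g \<in> ?P}"
      using normal(1)[OF g(2)] by (intro vec.span_base) blast
  qed
  \<comment> \<open>This vector is \<open>d v *s u\<close> with \<open>d v\<close> nonzero, so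
    \<open>refl_rep ?P\<close> contains the whole image of \<open>1 - s\<close>.\<close>
  then have "v - s *v v \<in> refl_rep ?P" using moves(1) by (intro vec.subspace_diff[OF sub]) auto
  then have "inverse (d v) *s (d v *s u) \<in> refl_rep ?P"
    using vec.subspace_scale[OF sub] by (simp only: u diff_diff_eq2 add_diff_cancel_left')
  moreover have "d v \<noteq> 0" using moves(2) u by auto
  ultimately have uP: "u \<in> refl_rep ?P" by simp
  have "s *v x = x" if x: "x \<in> M" for x
  proof -
    have "x - s *v x \<in> refl_rep ?P"
      using uP unfolding u by (simp add: vec.subspace_scale[OF sub])
    moreover have "g *v (x - s *v x) = x - s *v x" if g: "g \<in> ?P" for g
    proof -
      \<comment> \<open>Moving \<open>g\<close> past \<open>s\<close> turns it into a conjugate that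
        still lies in the stabilizer and therefore fixes \<open>x\<close>.\<close>
      have "g *v (s *v x) = s *v ((matrix_inv s ** g ** s) *v x)"
        by (simp add: mult_inv_vec sG flip: matrix_vector_mul_assoc)
      also have "\<dots> = s *v x" using normal(2)[OF g] x by (simp add: pw_stabilizer_def)
      finally show ?thesis using g x by (simp add: matrix_vector_mult_diff_distrib pw_stabilizer_def)
    qed
    ultimately have "x - s *v x = 0" by (rule P.refl_rep_fixed_trivial)
    then show ?thesis by simp
  qed
  then show ?thesis using sG by (simp add: pw_stabilizer_def)
qed

end

section \<open>Subgroups of \<open>GL\<close> and internal direct products\<close>

lemma subgroup_GL_finite_linear_group:
  assumes "subgroup W GL" "finite W"
  shows "finite_linear_group W"
proof
  have W: "W \<subseteq> {A. invertible A}" using subgroup.subset[OF assms(1)] by (simp add: GL_def)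
  show "invertible g" if "g \<in> W" for g using that W by blast
  show "finite W" by fact
  show "mat 1 \<in> W" using subgroup.one_closed[OF assms(1)] by (simp add: GL_def)
  show "g ** h \<in> W" if "g \<in> W" "h \<in> W" for g h
    using subgroup.m_closed[OF assms(1) that] by (simp add: GL_def)
  show "matrix_inv g \<in> W" if g: "g \<in> W" for g
  proof -
    have inv: "invertible g" using g W by blast
    have "m_inv GL g = matrix_inv g"
      unfolding m_inv_def
    proof (rule the_equality)
      show "matrix_inv g \<in> carrier GL \<and> g \<otimes>\<^bsub>GL\<^esub> matrix_inv g = \<one>\<^bsub>GL\<^esub> \<and> matrix_inv g \<otimes>\<^bsub>GL\<^esub> g = \<one>\<^bsub>GL\<^esub>"
        using matrix_inv_cancel[OF inv] by (auto simp: GL_def invertible_def)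
      show "y = matrix_inv g" if "y \<in> carrier GL \<and> g \<otimes>\<^bsub>GL\<^esub> y = \<one>\<^bsub>GL\<^esub> \<and> y \<otimes>\<^bsub>GL\<^esub> g = \<one>\<^bsub>GL\<^esub>" for y
        using that matrix_inv_eqI[of y g] by (simp add: GL_def)
    qed
    then show ?thesis using subgroup.m_inv_closed[OF assms(1) g] by simp
  qed
qed

lemma foldr_single_factor:
  assumes "distinct xs"
  shows "foldr (\<lambda>j A. (if j = i then x else mat 1) ** A) xs (mat 1) = (if i \<in> set xs then x else mat 1)"
  using assms by (induction xs) auto

text \<open>The tuple \<open>e i x\<close> has \<open>x\<close> in place \<open>i\<close> and the
  identity elsewhere. The isomorphism sends it to \<open>x\<close>, so relations in \<open>G\<close>
  can be checked componentwise.\<close>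

lemma internal_direct_product_factors:
  fixes G :: "(complex^'n^'n) set"
  assumes prod: "internal_direct_product G k P"
    and P: "\<And>i. i \<in> {1..k} \<Longrightarrow> finite_linear_group (P i)"
  shows "i \<in> {1..k} \<Longrightarrow> P i \<subseteq> G"
    and "w \<in> G \<Longrightarrow> i \<in> {1..k} \<Longrightarrow> x \<in> P i \<Longrightarrow> \<exists>y\<in>P i. w ** x = y ** w"
    and "w \<in> G \<Longrightarrow> \<exists>g. (\<forall>i\<in>{1..k}. g i \<in> P i) \<and> w = foldr (\<lambda>i A. g i ** A) [1..<Suc k] (mat 1)"
proof -
  let ?\<Phi> = "\<lambda>g. foldr (\<lambda>i A. g i ** A) [1..<Suc k] (mat 1)"
  let ?C = "\<Pi>\<^sub>E i\<in>{1..k}. P i"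
  have bij: "bij_betw ?\<Phi> ?C G"
    and hom: "\<And>g h. g \<in> ?C \<Longrightarrow> h \<in> ?C \<Longrightarrow> ?\<Phi> (\<lambda>i\<in>{1..k}. g i ** h i) = ?\<Phi> g ** ?\<Phi> h"
    using prod unfolding internal_direct_product_def iso_def hom_def GL_def by (simp_all del: upt_Suc)
  define e :: "nat \<Rightarrow> complex^'n^'n \<Rightarrow> nat \<Rightarrow> complex^'n^'n" where
    "e i x = (\<lambda>j\<in>{1..k}. if j = i then x else mat 1)" for i x
  have e: "e i x \<in> ?C" if "i \<in> {1..k}" "x \<in> P i" for i x
    using that finite_linear_group.one[OF P] by (auto simp: e_def)
  have \<Phi>e: "?\<Phi> (e i x) = x" if "i \<in> {1..k}" for i x
  proof -
    have "?\<Phi> (e i x) = foldr (\<lambda>j A. (if j = i then x else mat 1) ** A) [1..<Suc k] (mat 1)"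
      by (rule foldr_cong) (auto simp: e_def)
    then show ?thesis using that by (simp add: foldr_single_factor del: upt_Suc)
  qed
  show "P i \<subseteq> G" if "i \<in> {1..k}"
  proof
    fix x assume "x \<in> P i"
    then have "?\<Phi> (e i x) \<in> G" using bij_betwE[OF bij] e[OF that] by blast
    then show "x \<in> G" by (simp only: \<Phi>e[OF that])
  qed
  have surj: "\<exists>g\<in>?C. w = ?\<Phi> g" if "w \<in> G" for w
    using that bij by (auto simp: bij_betw_def)
  show "\<exists>g. (\<forall>i\<in>{1..k}. g i \<in> P i) \<and> w = ?\<Phi> g" if "w \<in> G"
    using surj[OF that] by (auto simp: PiE_iff)
  show "\<exists>y\<in>P i. w ** x = y ** w" if wix: "w \<in> G" "i \<in> {1..k}" "x \<in> P i"
  proof -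
    interpret Pi: finite_linear_group "P i" using P wix by blast
    obtain g where g: "g \<in> ?C" "w = ?\<Phi> g" using surj wix by blast
    then have gi: "g i \<in> P i" using wix by auto
    define y where "y = g i ** x ** matrix_inv (g i)"
    have y: "y \<in> P i" using gi wix by (simp add: y_def Pi.mult Pi.inv)
    \<comment> \<open>In component \<open>i\<close> both sides are \<open>g i ** x\<close>; in every
      other component \<open>j\<close> they are \<open>g j\<close>.\<close>
    have "(\<lambda>j\<in>{1..k}. g j ** e i x j) = (\<lambda>j\<in>{1..k}. e i y j ** g j)"
      by (auto simp: e_def y_def Pi.inv_mult[OF gi] simp flip: matrix_mul_assoc)
    then have "?\<Phi> g ** ?\<Phi> (e i x) = ?\<Phi> (e i y) ** ?\<Phi> g"
      using hom[OF g(1) e[OF wix(2,3)]] hom[OF e[OF wix(2) y] g(1)] by simp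
    then have "w ** x = y ** w" by (simp only: g(2)[symmetric] \<Phi>e[OF wix(2)])
    then show ?thesis using y by blast
  qed
qed

section \<open>Invariance of the parabolic ideal\<close>

locale parabolic_in_group = finite_linear_group G for G :: "(complex^'n^'n) set" +
  fixes L :: "(complex^'n) set" and k :: nat and P :: "nat \<Rightarrow> (complex^'n^'n) set"
    and a :: "complex^'n^'n \<Rightarrow> complex" and \<alpha> :: "(complex^'n) set \<Rightarrow> complex^'n \<Rightarrow> complex"
    and \<beta> :: "complex^'n^'n \<Rightarrow> complex^'n \<Rightarrow> complex" and \<gamma> :: "complex^'n^'n \<Rightarrow> complex^'n"
  assumes a_inv: "refl_invariant G a"
    and \<alpha>: "\<forall>H\<in>hyperplanes G. \<alpha> H \<in> covectors \<and> \<alpha> H \<noteq> (\<lambda>v. 0) \<and> (\<forall>v\<in>H. \<alpha> H v = 0)"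
    and \<beta>\<gamma>: "\<forall>s\<in>reflections G. \<forall>f\<in>covectors. act s f = (\<lambda>v. f v - f (\<gamma> s) * \<beta> s v)"
    and L: "hyperplane_intersection G L"
    and P: "\<forall>i\<in>{1..k}. irreducible_parabolic G (P i)"
    and prod: "internal_direct_product (pw_stabilizer G L) k P"
begin

abbreviation "G0 \<equiv> pw_stabilizer G L"

sublocale G0: finite_linear_group G0
  by (rule pw_stabilizer_group)

lemma subspace_L: "vec.subspace L"
  using L by (rule subspace_hyperplane_intersection)

lemma factor_parabolic:
  assumes "i \<in> {1..k}"
  obtains M where "hyperplane_intersection G M" "P i = pw_stabilizer G M"
  using P assms unfolding irreducible_parabolic_def parabolic_subgroup_def by blast

lemma factor_group: "i \<in> {1..k} \<Longrightarrow> finite_linear_group (P i)"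
  using factor_parabolic pw_stabilizer_group by metis

lemmas factors = internal_direct_product_factors[OF prod factor_group]

lemma factor_subset: "i \<in> {1..k} \<Longrightarrow> P i \<subseteq> G0"
  by (rule factors(1))

lemma factor_normal:
  assumes w: "w \<in> G0" and i: "i \<in> {1..k}" and x: "x \<in> P i"
  shows "w ** x ** matrix_inv w \<in> P i"
proof -
  obtain y where "y \<in> P i" "w ** x = y ** w" using factors(2)[OF _ w i x] by blast
  then show ?thesis by (simp add: G0.mult_inv[OF w] flip: matrix_mul_assoc)
qed

lemma G0_subset: "G0 \<subseteq> G" and reflections_G0_subset: "reflections G0 \<subseteq> reflections G"
  by (auto simp: pw_stabilizer_def reflections_def)

text \<open>The factor is normal in \<open>G0\<close>, so by the dichotomy a reflection of
  \<open>G0\<close> outside it fixes \<open>v\<close> and drops out of the sum. What remains is the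
  operator of the factor itself.\<close>

lemma refl_op_on_factor:
  assumes i: "i \<in> {1..k}" and v: "v \<in> refl_rep (P i)"
  shows "refl_op (reflections G0) a v = h_const (P i) a \<beta> \<gamma> *s v"
proof -
  interpret Pi: finite_linear_group "P i" by (rule factor_group[OF i])
  obtain M where M: "hyperplane_intersection G M" "P i = pw_stabilizer G M"
    using factor_parabolic[OF i] by blast
  have sub: "reflections (P i) \<subseteq> reflections G0"
    using factor_subset[OF i] by (auto simp: reflections_def)
  have "refl_op (reflections G0) a v = refl_op (reflections (P i)) a v"
    unfolding refl_op_def
  proof (rule sum.mono_neutral_right[OF G0.finite_reflections sub], safe)
    fix s assume s: "s \<in> reflections G0" "s \<notin> reflections (P i)"
    then have s0: "s \<in> G0" and "s \<notin> P i" by (auto simp: reflections_def)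
    have "s *v v = v"
    proof (rule ccontr)
      assume moves: "s *v v \<noteq> v"
      have sG: "s \<in> reflections G" using s(1) reflections_G0_subset by blast
      have n1: "s ** x ** matrix_inv s \<in> pw_stabilizer G M" if "x \<in> pw_stabilizer G M" for x
        using factor_normal[OF s0 i, of x] that by (simp add: M(2))
      have n2: "matrix_inv s ** x ** s \<in> pw_stabilizer G M" if "x \<in> pw_stabilizer G M" for x
        using factor_normal[OF G0.inv[OF s0] i, of x] that by (simp add: M(2) G0.inv_inv[OF s0])
      have "v \<in> refl_rep (pw_stabilizer G M)" using v by (simp add: M(2))
      from reflection_parabolic_dichotomy[OF M(1) sG n1 n2 this moves]
      have "s \<in> pw_stabilizer G M" .
      with \<open>s \<notin> P i\<close> M(2) show False by simp
    qed
    then have "matrix_inv s *v v = v" by (rule G0.fixes_inv[OF s0])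
    then show "a s *s (v - matrix_inv s *v v) = 0" by simp
  qed
  also have "\<dots> = h_const (P i) a \<beta> \<gamma> *s v"
  proof (rule Pi.h_const_refl_op[OF _ _ _ v])
    show "irreducible_on (P i) (refl_rep (P i))" using P i by (simp add: irreducible_parabolic_def)
    have "P i \<subseteq> G" "reflections (P i) \<subseteq> reflections G"
      using factor_subset[OF i] G0_subset sub reflections_G0_subset by blast+
    then show "a (g ** s ** matrix_inv g) = a s" if "g \<in> P i" "s \<in> reflections (P i)" for g s
      using a_inv that unfolding refl_invariant_def by blast
    show "act s f v = f v - f (\<gamma> s) * \<beta> s v" if "s \<in> reflections (P i)" "f \<in> covectors" for s f v
      using \<beta>\<gamma> that \<open>reflections (P i) \<subseteq> reflections G\<close> by auto
  qed
  finally show ?thesis .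
qed

lemma refl_op_fixed_L: "v \<in> L \<Longrightarrow> refl_op (reflections G0) a v = 0"
  unfolding refl_op_def
proof (rule sum.neutral, safe)
  fix s assume "v \<in> L" "s \<in> reflections G0"
  then have "matrix_inv s *v v = v"
    by (intro G0.fixes_inv) (auto simp: reflections_def pw_stabilizer_def)
  then show "a s *s (v - matrix_inv s *v v) = 0" by simp
qed

text \<open>This is the spanning half of the decomposition of the space. A group element is a
  product over the factors, so \<open>v - g *v v\<close> telescopes into their reflection
  representations, while the sum of all \<open>g *v v\<close> lies in \<open>L\<close>.\<close>

lemma subspace_containing_factors:
  assumes X: "vec.subspace X" and LX: "L \<subseteq> X" and PX: "\<And>i. i \<in> {1..k} \<Longrightarrow> refl_rep (P i) \<subseteq> X"
  shows "v \<in> X"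
proof -
  have fold: "v - foldr (\<lambda>i A. g i ** A) is (mat 1) *v v \<in> X"
    if "set is \<subseteq> {1..k}" "\<forall>i\<in>{1..k}. g i \<in> P i" for g v "is"
    using that(1)
  proof (induction "is")
    case Nil
    then show ?case using vec.subspace_0[OF X] by simp
  next
    case (Cons i "is")
    let ?w = "foldr (\<lambda>i A. g i ** A) is (mat 1) *v v"
    have "v - ?w \<in> X" using Cons by simp
    moreover have "?w - g i *v ?w \<in> X"
    proof -
      have "?w - g i *v ?w \<in> refl_rep (P i)"
        using Cons.prems that(2) unfolding refl_rep_def by (intro vec.span_base) auto
      then show ?thesis using PX[of i] Cons.prems by auto
    qed
    ultimately have "(v - ?w) + (?w - g i *v ?w) \<in> X" by (rule vec.subspace_add[OF X])
    then show ?case by (simp add: matrix_vector_mul_assoc)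
  qed
  have "v - g *v v \<in> X" if g: "g \<in> G0" for g
  proof -
    obtain c where c: "\<forall>i\<in>{1..k}. c i \<in> P i" "g = foldr (\<lambda>i A. c i ** A) [1..<Suc k] (mat 1)"
      using factors(3)[OF _ g] by blast
    have "set [1..<Suc k] \<subseteq> {1..k}" by auto
    from fold[OF this c(1), of v] show ?thesis unfolding c(2) .
  qed
  then have "(\<Sum>g\<in>G0. v - g *v v) \<in> X" by (intro vec.subspace_sum[OF X])
  moreover have "(\<Sum>g\<in>G0. g *v v) \<in> X"
    using LX fixed_by_pw_stabilizer[OF L G0.group_sum_fixed] by blast
  \<comment> \<open>The two sums add up to \<open>card G0\<close> times \<open>v\<close>.\<close>
  ultimately have "(\<Sum>g\<in>G0. v - g *v v) + (\<Sum>g\<in>G0. g *v v) \<in> X" by (rule vec.subspace_add[OF X])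
  then have "(\<Sum>g\<in>G0. v) \<in> X" by (simp only: sum.distrib[symmetric] diff_add_cancel)
  then have "inverse (of_nat (card G0)) *s (of_nat (card G0) *s v) \<in> X"
    unfolding vec.sum_constant_scale by (rule vec.subspace_scale[OF X])
  then show ?thesis using G0.card_pos by simp
qed

text \<open>The form vanishes on \<open>L\<close>, where both \<open>f\<close> and the operator are
  zero, and on each factor's reflection representation, where the operator is the identity; these
  subspaces span.\<close>

lemma covector_zero_on_L_refl_op:
  assumes h: "\<forall>i\<in>{1..k}. h_const (P i) a \<beta> \<gamma> = 1" and f: "f \<in> covectors" "\<And>v. v \<in> L \<Longrightarrow> f v = 0"
  shows "f (v - refl_op (reflections G0) a v) = 0"
proof -
  let ?f = "\<lambda>v. f v - f (refl_op (reflections G0) a v)"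
  have "?f \<in> covectors"
    using f(1) linear_refl_op[of "reflections G0" a]
    by (auto simp: covectors_iff Vector_Spaces.linear_iff algebra_simps)
  then have "v \<in> {v. ?f v = 0}"
    using refl_op_on_factor h f
    by (intro subspace_containing_factors subspace_covector_kernel) (auto simp: refl_op_fixed_L covector_0)
  then show ?thesis using f(1) by (simp add: covector_diff)
qed

section \<open>Dunkl operators at generic points of a translate of \<open>L\<close>\<close>

text \<open>By genericity the reflections fixing \<open>x\<close> are those fixing the translate
  pointwise, which are the conjugates by \<open>w\<close> of the reflections of
  \<open>G0\<close>.\<close>

lemma generic_dunkl:
  assumes p: "p \<in> parabolic_ideal G L" and w: "w \<in> G" and x: "x \<in> (*v) w ` L"
    and generic: "\<And>H. H \<in> hyperplanes G \<Longrightarrow> \<not> (*v) w ` L \<subseteq> H \<Longrightarrow> x \<notin> H"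
    and f: "f \<in> covectors" "\<And>v. ((\<lambda>t. p (x + t *s v)) has_field_derivative f v) (at 0)"
  shows "dunkl G a \<alpha> \<xi> p x = f (\<xi> - w *v refl_op (reflections G0) a (matrix_inv w *v \<xi>))"
proof -
  let ?c = "\<lambda>s. w ** s ** matrix_inv w"
  have "dunkl G a \<alpha> \<xi> p x = f (\<xi> - refl_op {s \<in> reflections G. s *v x = x} a \<xi>)"
  proof (rule dunkl_at_orbit_zero[OF \<alpha> _ _ f])
    show "p \<in> polynomials" using p by (simp add: parabolic_ideal_def)
    obtain y where y: "y \<in> L" "x = w *v y" using x by blast
    show "p (g *v x) = 0" if "g \<in> G" for g
    proof -
      have "g *v x = (g ** w) *v y" by (simp add: y(2) matrix_vector_mul_assoc)
      then have "g *v x \<in> parabolic_stratum G L"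
        using y(1) mult[OF that w] unfolding parabolic_stratum_def by blast
      then show ?thesis using p by (simp add: parabolic_ideal_def)
    qed
  qed
  moreover have "{s \<in> reflections G. s *v x = x} = ?c ` reflections G0"
  proof
    show "?c ` reflections G0 \<subseteq> {s \<in> reflections G. s *v x = x}"
    proof safe
      fix s assume s: "s \<in> reflections G0"
      then show "?c s \<in> reflections G" using reflections_G0_subset reflections_conj[OF w] by blast
      obtain y where y: "y \<in> L" "x = w *v y" using x by blast
      then show "?c s *v x = x"
        using s by (simp add: inv_mult_vec[OF w] reflections_def pw_stabilizer_def flip: matrix_vector_mul_assoc)
    qed
    show "{s \<in> reflections G. s *v x = x} \<subseteq> ?c ` reflections G0"
    proof safe
      fix s assume s: "s \<in> reflections G" "s *v x = x"
      have "fixed_space s \<in> hyperplanes G" "x \<in> fixed_space s"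
        using s by (auto simp: hyperplanes_def fixed_space_def)
      then have wL: "(*v) w ` L \<subseteq> fixed_space s" using generic by blast
      define r where "r = matrix_inv w ** s ** w"
      have "r \<in> reflections G"
        using reflections_conj[OF inv[OF w] s(1)] by (simp add: r_def inv_inv[OF w])
      moreover have "r *v y = y" if "y \<in> L" for y
      proof -
        have "s *v (w *v y) = w *v y" using wL that by (auto simp: fixed_space_def)
        then show ?thesis by (simp add: r_def inv_mult_vec[OF w] flip: matrix_vector_mul_assoc)
      qed
      ultimately have "r \<in> reflections G0"
        unfolding reflections_pw_stabilizer by (auto simp: fixed_space_def)
      moreover have "?c r = (w ** matrix_inv w) ** s ** (w ** matrix_inv w)"
        by (simp only: r_def matrix_mul_assoc)
      then have "s = ?c r" by (simp add: mult_inv[OF w])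
      ultimately show "s \<in> ?c ` reflections G0" by blast
    qed
  qed
  moreover have "refl_op (?c ` reflections G0) a \<xi> = w *v refl_op (reflections G0) a (matrix_inv w *v \<xi>)"
  proof -
    have "reflections G0 \<subseteq> G" using G0_subset by (auto simp: reflections_def)
    moreover have "a (?c s) = a s" if "s \<in> reflections G0" for s
      using a_inv w that reflections_G0_subset unfolding refl_invariant_def by blast
    ultimately show ?thesis
      using refl_op_conj[OF w, of "reflections G0" a "matrix_inv w *v \<xi>"] by (simp add: mult_inv_vec[OF w])
  qed
  ultimately show ?thesis by simp
qed

section \<open>The two implications\<close>

lemma hyperplane_covector_nonzero:
  assumes "H \<in> hyperplanes G"
  shows "\<alpha> H x \<noteq> 0 \<longleftrightarrow> x \<notin> H"
  using hyperplane_eq_kernel[OF reflection_hyperplane[OF assms], of "\<alpha> H"] \<alpha> assms by blast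

lemma subspace_image: "vec.subspace ((*v) w ` L)"
  by (rule vec.subspace_image[OF subspace_L])

text \<open>At a generic point the value is the gradient, pulled back by \<open>w\<close>, at a
  vector covered by \<open>covector_zero_on_L_refl_op\<close>; density settles the rest of each
  translate.\<close>

lemma ideal_invariant_if:
  assumes h: "\<forall>i\<in>{1..k}. h_const (P i) a \<beta> \<gamma> = 1" and p: "p \<in> parabolic_ideal G L"
  shows "dunkl G a \<alpha> \<xi> p \<in> parabolic_ideal G L"
proof -
  have poly: "dunkl G a \<alpha> \<xi> p \<in> polynomials"
    using p by (intro dunkl_polynomial[OF \<alpha>]) (simp add: parabolic_ideal_def)
  have "dunkl G a \<alpha> \<xi> p y = 0" if w: "w \<in> G" and y: "y \<in> (*v) w ` L" for w y
  proof (rule polynomial_vanishes_if_generic[where F = "\<alpha> ` {H \<in> hyperplanes G. \<not> (*v) w ` L \<subseteq> H}", OF subspace_image _ _ _ poly _ y])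
    show "finite (\<alpha> ` {H \<in> hyperplanes G. \<not> (*v) w ` L \<subseteq> H})" using finite_hyperplanes by simp
    show "\<alpha> ` {H \<in> hyperplanes G. \<not> (*v) w ` L \<subseteq> H} \<subseteq> covectors" using \<alpha> by auto
    show "\<exists>x\<in>(*v) w ` L. f x \<noteq> 0" if "f \<in> \<alpha> ` {H \<in> hyperplanes G. \<not> (*v) w ` L \<subseteq> H}" for f
      using that hyperplane_covector_nonzero by blast
    fix x assume x: "x \<in> (*v) w ` L" and gen: "\<And>f. f \<in> \<alpha> ` {H \<in> hyperplanes G. \<not> (*v) w ` L \<subseteq> H} \<Longrightarrow> f x \<noteq> 0"
    have "p \<in> polynomials" using p by (simp add: parabolic_ideal_def)
    then obtain f where f: "f \<in> covectors"
        "\<And>v. ((\<lambda>t. p (x + t *s v)) has_field_derivative f v) (at 0)"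
      using polynomial_gradient[of p x] by blast
    let ?\<eta> = "matrix_inv w *v \<xi>"
    have "x \<notin> H" if "H \<in> hyperplanes G" "\<not> (*v) w ` L \<subseteq> H" for H
      using gen[of "\<alpha> H"] that hyperplane_covector_nonzero by blast
    then have "dunkl G a \<alpha> \<xi> p x = f (\<xi> - w *v refl_op (reflections G0) a ?\<eta>)"
      by (rule generic_dunkl[OF p w x _ f])
    also have "\<xi> - w *v refl_op (reflections G0) a ?\<eta> = w *v (?\<eta> - refl_op (reflections G0) a ?\<eta>)"
      by (simp add: matrix_vector_mult_diff_distrib mult_inv_vec[OF w])
    also have "f \<dots> = 0"
    proof (rule covector_zero_on_L_refl_op[OF h, of "\<lambda>v. f (w *v v)"])
      show "(\<lambda>v. f (w *v v)) \<in> covectors" using f(1) by (rule covector_compose)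
      show "f (w *v v) = 0" if v: "v \<in> L" for v
      proof -
        \<comment> \<open>\<open>p\<close> is zero along the translate, so its derivative in the
          direction \<open>w *v v\<close> is zero.\<close>
        have "p (x + t *s (w *v v)) = 0" for t
        proof -
          have "x + t *s (w *v v) \<in> (*v) w ` L"
            using x v by (intro vec.subspace_add[OF subspace_image] vec.subspace_scale[OF subspace_image]) auto
          then have "x + t *s (w *v v) \<in> parabolic_stratum G L"
            using w unfolding parabolic_stratum_def by blast
          then show ?thesis using p by (simp add: parabolic_ideal_def)
        qed
        then have "((\<lambda>t. 0) has_field_derivative f (w *v v)) (at 0)" using f(2)[of "w *v v"] by simp
        then show ?thesis using DERIV_unique[OF _ DERIV_const] by blast
      qed
    qed
    finally show "dunkl G a \<alpha> \<xi> p x = 0" .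
  qed
  then show ?thesis using poly by (auto simp: parabolic_ideal_def parabolic_stratum_def)
qed

text \<open>The factor fixes every vector of \<open>L\<close>, but no nonzero vector of its
  reflection representation.\<close>

lemma factor_not_in_L:
  assumes i: "i \<in> {1..k}" and v: "v \<in> refl_rep (P i)" "v \<noteq> 0"
  shows "v \<notin> L"
proof
  interpret Pi: finite_linear_group "P i" by (rule factor_group[OF i])
  assume "v \<in> L"
  then have "g *v v = v" if "g \<in> P i" for g
    using that factor_subset[OF i] by (auto simp: pw_stabilizer_def)
  then show False using Pi.refl_rep_fixed_trivial v by blast
qed

text \<open>The test element is \<open>l\<close> times forms killing the translates other than
  \<open>L\<close>. At a generic point of \<open>L\<close> its gradient is a nonzero multiple of
  \<open>l\<close>, so invariance says that \<open>1 - h\<close> times \<open>l v\<close> is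
  zero.\<close>

lemma h_const_if_ideal_invariant:
  assumes invariant: "\<forall>\<xi>. \<forall>p\<in>parabolic_ideal G L. dunkl G a \<alpha> \<xi> p \<in> parabolic_ideal G L"
    and i: "i \<in> {1..k}"
  shows "h_const (P i) a \<beta> \<gamma> = 1"
proof -
  have "irreducible_on (P i) (refl_rep (P i))" using P i by (simp add: irreducible_parabolic_def)
  then obtain v where v: "v \<in> refl_rep (P i)" "v \<noteq> 0"
    using vec.subspace_0 unfolding irreducible_on_def by blast
  then have "v \<notin> L" by (rule factor_not_in_L[OF i])
  then obtain l where l: "l \<in> covectors" "\<And>x. x \<in> L \<Longrightarrow> l x = 0" "l v \<noteq> 0"
    using separating_covector[OF subspace_L] by blast
  define N where "N = {w \<in> G. \<not> L \<subseteq> (*v) w ` L}"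
  have "\<exists>q. q \<in> covectors \<and> (\<forall>x\<in>(*v) w ` L. q x = 0) \<and> (\<exists>y\<in>L. q y \<noteq> 0)" if wN: "w \<in> N" for w
  proof -
    obtain y where y: "y \<in> L" "y \<notin> (*v) w ` L" using wN unfolding N_def by blast
    obtain q where "q \<in> covectors" "\<And>x. x \<in> (*v) w ` L \<Longrightarrow> q x = 0" "q y \<noteq> 0"
      using separating_covector[OF subspace_image y(2)] by metis
    then show ?thesis using y(1) by blast
  qed
  then obtain q where q: "\<And>w. w \<in> N \<Longrightarrow> q w \<in> covectors"
      "\<And>w x. w \<in> N \<Longrightarrow> x \<in> (*v) w ` L \<Longrightarrow> q w x = 0" "\<And>w. w \<in> N \<Longrightarrow> \<exists>y\<in>L. q w y \<noteq> 0"
    by metis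
  have finN: "finite N" using finite_group by (simp add: N_def)
  \<comment> \<open>Avoiding the zeros of the \<open>q w\<close> keeps \<open>R x\<close> nonzero;
    avoiding the hyperplanes that do not contain \<open>L\<close> is the genericity of
    \<open>generic_dunkl\<close>.\<close>
  let ?F = "q ` N \<union> \<alpha> ` {H \<in> hyperplanes G. \<not> L \<subseteq> H}"
  obtain x where x: "x \<in> L" "\<And>f. f \<in> ?F \<Longrightarrow> f x \<noteq> 0"
  proof (rule generic_point[OF subspace_L, of ?F])
    show "finite ?F" using finN finite_hyperplanes by simp
    show "?F \<subseteq> covectors" using q(1) \<alpha> by auto
    show "\<exists>x\<in>L. f x \<noteq> 0" if "f \<in> ?F" for f
      using that q(3) hyperplane_covector_nonzero by blast
  qed (use that in blast)
  define R where "R y = (\<Prod>w\<in>N. q w y)" for y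
  have R: "R \<in> polynomials"
    unfolding R_def using q(1) by (intro polynomials_prod) (auto intro: polynomials.covector)
  have Rx: "R x \<noteq> 0" using x(2) finN by (auto simp: R_def)
  define p where "p y = l y * R y" for y
  have "p \<in> polynomials"
    unfolding p_def using l(1) R by (intro polynomials.mult) (auto intro: polynomials.covector)
  moreover have "p y = 0" if w: "w \<in> G" and y: "y \<in> (*v) w ` L" for w y
  proof (cases "w \<in> N")
    case True
    then have "R y = 0" unfolding R_def using finN q(2)[OF True y] by (intro prod_zero) auto
    then show ?thesis by (simp add: p_def)
  next
    case False
    then have "L \<subseteq> (*v) w ` L" using w by (simp add: N_def)
    \<comment> \<open>A translate has the dimension of \<open>L\<close>, so one that contains
      \<open>L\<close> equals it and \<open>l\<close> vanishes there.\<close>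
    then have "L = (*v) w ` L"
      by (rule vec.subspace_dim_equal[OF subspace_L subspace_image]) (simp add: dim_image[OF w])
    then show ?thesis using y l(2) by (simp add: p_def)
  qed
  ultimately have p: "p \<in> parabolic_ideal G L"
    by (auto simp: parabolic_ideal_def parabolic_stratum_def)
  \<comment> \<open>As \<open>l x = 0\<close>, the product rule leaves only this term in the
    gradient of \<open>p\<close> at \<open>x\<close>.\<close>
  define f where "f z = R x * l z" for z
  have f: "f \<in> covectors" using l(1) by (simp add: f_def covectors_iff algebra_simps)
  have df: "((\<lambda>t. p (x + t *s z)) has_field_derivative f z) (at 0)" for z
  proof -
    obtain g where g: "((\<lambda>t. R (x + t *s z)) has_field_derivative g) (at 0)"
      using polynomial_gradient[OF R, of x] by metis
    have "((\<lambda>t. l (x + t *s z)) has_field_derivative l z) (at 0)"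
      using l(1) by (auto simp: covector_line intro!: derivative_eq_intros)
    from DERIV_mult[OF this g] show ?thesis using l(2)[OF x(1)] by (simp add: p_def f_def mult.commute)
  qed
  have L1: "(*v) (mat 1) ` L = L" by simp
  have "dunkl G a \<alpha> v p x = f (v - mat 1 *v refl_op (reflections G0) a (matrix_inv (mat 1) *v v))"
  proof (rule generic_dunkl[OF p one _ _ f df])
    show "x \<in> (*v) (mat 1) ` L" using x(1) L1 by simp
    show "x \<notin> H" if "H \<in> hyperplanes G" "\<not> (*v) (mat 1) ` L \<subseteq> H" for H
      using x(2)[of "\<alpha> H"] that hyperplane_covector_nonzero unfolding L1 by blast
  qed
  also have "matrix_inv (mat 1) = (mat 1 :: complex^'n^'n)" by (rule matrix_inv_eqI) simp
  also have "f (v - mat 1 *v refl_op (reflections G0) a (mat 1 *v v)) = (1 - h_const (P i) a \<beta> \<gamma>) * f v"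
    by (simp add: refl_op_on_factor[OF i v(1)] covector_diff[OF f] covector_scale[OF f] algebra_simps)
  finally have "(1 - h_const (P i) a \<beta> \<gamma>) * f v = dunkl G a \<alpha> v p x" by simp
  also have "x \<in> parabolic_stratum G L"
    using x(1) one L1 unfolding parabolic_stratum_def by blast
  then have "dunkl G a \<alpha> v p x = 0"
    using invariant p by (simp add: parabolic_ideal_def)
  finally show ?thesis using Rx l(3) by (simp add: f_def)
qed

end

theorem theorem11:
  fixes W W\<^sub>0 :: "(complex^'n^'n) set"
    and a :: "complex^'n^'n \<Rightarrow> complex"
    and \<alpha> :: "(complex^'n) set \<Rightarrow> complex^'n \<Rightarrow> complex"
    and \<beta> :: "complex^'n^'n \<Rightarrow> complex^'n \<Rightarrow> complex"
    and \<gamma> :: "complex^'n^'n \<Rightarrow> complex^'n"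
    and L :: "(complex^'n) set"
    and k :: nat
    and P :: "nat \<Rightarrow> (complex^'n^'n) set"
  assumes "irreducible_reflection_group W"
    and "refl_invariant W a"
    and "\<forall>H\<in>hyperplanes W. \<alpha> H \<in> covectors \<and> \<alpha> H \<noteq> (\<lambda>v. 0) \<and> (\<forall>v\<in>H. \<alpha> H v = 0)"
    and "\<forall>s\<in>reflections W. \<beta> s \<in> covectors \<and>
           (\<forall>f\<in>covectors. act s f = (\<lambda>v. f v - f (\<gamma> s) * \<beta> s v))"
    and "hyperplane_intersection W L"
    and "W\<^sub>0 = pw_stabilizer W L"
    and "\<forall>i\<in>{1..k}. irreducible_parabolic W (P i)"
    and "internal_direct_product W\<^sub>0 k P"
  shows "(\<forall>\<xi>. \<forall>p\<in>parabolic_ideal W L. dunkl W a \<alpha> \<xi> p \<in> parabolic_ideal W L) \<longleftrightarrow>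
         (\<forall>i\<in>{1..k}. h_const (P i) a \<beta> \<gamma> = 1)"
proof -
  have "finite_linear_group W"
    using assms(1) by (auto simp: irreducible_reflection_group_def intro: subgroup_GL_finite_linear_group)
  then interpret finite_linear_group W .
  interpret parabolic_in_group W L k P a \<alpha> \<beta> \<gamma>
  proof (intro parabolic_in_group.intro parabolic_in_group_axioms.intro)
    show "\<forall>s\<in>reflections W. \<forall>f\<in>covectors. act s f = (\<lambda>v. f v - f (\<gamma> s) * \<beta> s v)"
      using assms(4) by blast
    show "internal_direct_product (pw_stabilizer W L) k P"
      using assms(8) unfolding assms(6) .
  qed fact+
  show ?thesis using ideal_invariant_if h_const_if_ideal_invariant by blast
qed

end
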